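(* Let $a>b>0$, $c^2=a^2-b^2$, let $\mathcal{E}$ be the ellipse $x^2/a^2+y^2/b^2=1$, and let $C=[x_c,y_c]$ be a point interior to $\mathcal{E}$. Let $\mathcal{T}_\circ$ be the Poncelet family of triangles inscribed in $\mathcal{E}$ and circumscribing a circle centered at $C$. Put $\delta=\sqrt{(b^4+c^2y_c^2)(a^4-c^2x_c^2)}$, \[ z_2=a^6b^2-9a^6y_c^2-a^4b^2x_c^2,\qquad z_1=z_2-2a^4b^4-6a^4b^2y_c^2+a^2b^6-6a^2b^4x_c^2-a^2b^4y_c^2-9b^6x_c^2, \] and assume $z_1\neq0$. Then the locus $\mathcal{L}_{36}$ of the triangle center $X_{36}$ over $\mathcal{T}_\circ$ is a circle, with center $C_{36}=[x_{36}/z_1,\;y_{36}/z_1]$, where \[ x_{36}=x_c\left(z_2-6a^4b^4+6a^4b^2y_c^2-3a^2b^6-2a^2b^4x_c^2+3a^2b^4y_c^2-8ab^3\delta+3b^6x_c^2\right), \] \[ y_{36}=y_c\left(3a^6(y_c^2-b^2)-a^4\left(6b^4+b^2(2y_c^2-3x_c^2)\right)-8a^3b\,\delta+a^2b^4(b^2+6x_c^2-y_c^2)-9b^6x_c^2\right), \] and with radius \[ r_{36}=\left|\frac{2(\delta_4z_{36}-\delta_4'z_{36}')}{a^2b^2c^4-b^2(a^2+3b^2)^2x_c^2-a^2(3a^2+b^2)^2y_c^2}\right|, \] where \[ z_{36}=5ba^4y_c^2-b^3a^2(a^2+y_c^2-x_c^2)+b^5(a^2+3x_c^2),\qquad z_{36}'=5ab^4x_c^2-a^3b^2(b^2+x_c^2-y_c^2)+a^5(b^2+3y_c^2),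 \] $\delta_4=\sqrt{a^4-c^2x_c^2}$ and $\delta_4'=\sqrt{b^4+c^2y_c^2}$.
   Context: For each point $C=[x_c,y_c]$ interior to $\mathcal{E}$ there is exactly one circle $\mathcal{K}$ centered at $C$, nested in $\mathcal{E}$, admitting triangles inscribed in $\mathcal{E}$ with all sides tangent to $\mathcal{K}$; its radius is $r=\big(b\sqrt{a^4-c^2x_c^2}-a\sqrt{b^4+c^2y_c^2}\big)/c^2$. By Poncelet's porism every point of $\mathcal{E}$ is then a vertex of exactly one such triangle. $\mathcal{T}_\circ$ is the family of all these triangles; $\mathcal{K}$ is their common incircle, so the incenter $X_1=C$ is fixed. The locus $\mathcal{L}_k$ of a triangle center $X_k$ is the set of positions of $X_k(T)$ as $T$ ranges over $\mathcal{T}_\circ$. $X_{36}$ is the inverse of the incenter $X_1$ with respect to the circumcircle of the triangle. The condition $z_1=0$ is equivalent to $C$ lying on the ellipse centered at the origin, axis-aligned with $\mathcal{E}$, of semi-axes $\frac{ac^2}{a^2+3b^2}$, $\frac{bc^2}{3a^2+b^2}$ (the locus of centroids of equilateral triangles inscribed in $\mathcal{E}$). *)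

theory Defs
  imports "HOL-Analysis.Analysis"
begin

type_synonym point = "real \<times> real"

definition ellipse :: "real \<Rightarrow> real \<Rightarrow> point set" where
  "ellipse a b = {(x, y). x\<^sup>2 / a\<^sup>2 + y\<^sup>2 / b\<^sup>2 = 1}"

definition ellipse_interior :: "real \<Rightarrow> real \<Rightarrow> point set" where
  "ellipse_interior a b = {(x, y). x\<^sup>2 / a\<^sup>2 + y\<^sup>2 / b\<^sup>2 < 1}"

definition tangent_to_circle :: "point set \<Rightarrow> point \<Rightarrow> real \<Rightarrow> bool" where
  "tangent_to_circle L C r \<longleftrightarrow> (\<exists>!X. X \<in> L \<inter> sphere C r)"

text \<open>A side is represented by the line carrying it. Since the circle is required to lie inside
  the ellipse, it meets such a line only between the two vertices, so the circle
  is the incircle and never an excircle.\<close>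

definition poncelet_triangles :: "real \<Rightarrow> real \<Rightarrow> point \<Rightarrow> (point \<times> point \<times> point) set" where
  "poncelet_triangles a b C =
     {(P, Q, R). P \<in> ellipse a b \<and> Q \<in> ellipse a b \<and> R \<in> ellipse a b \<and>
        \<not> collinear {P, Q, R} \<and>
        (\<exists>r>0. sphere C r \<subseteq> ellipse_interior a b \<and>
           tangent_to_circle (affine hull {P, Q}) C r \<and>
           tangent_to_circle (affine hull {Q, R}) C r \<and>
           tangent_to_circle (affine hull {R, P}) C r)}"

text \<open>The incenter is given by its barycentric coordinates, the side lengths opposite to
  the vertices.\<close>

definition incenter :: "point \<Rightarrow> point \<Rightarrow> point \<Rightarrow> point" where
  "incenter P Q R =
     (1 / (dist Q R + dist R P + dist P Q)) *\<^sub>R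
       (dist Q R *\<^sub>R P + dist R P *\<^sub>R Q + dist P Q *\<^sub>R R)"

definition circumcenter :: "point \<Rightarrow> point \<Rightarrow> point \<Rightarrow> point" where
  "circumcenter P Q R = (THE M. dist M P = dist M Q \<and> dist M Q = dist M R)"

definition circumradius :: "point \<Rightarrow> point \<Rightarrow> point \<Rightarrow> real" where
  "circumradius P Q R = dist (circumcenter P Q R) P"

definition circle_inverse :: "point \<Rightarrow> real \<Rightarrow> point \<Rightarrow> point" where
  "circle_inverse M \<rho> X = M + (\<rho>\<^sup>2 / (dist M X)\<^sup>2) *\<^sub>R (X - M)"

text \<open>For an equilateral triangle incenter and circumcenter coincide and \<open>X36\<close> is
  mathematically undefined; the definition below then returns the circumcenter.\<close>

definition X36 :: "point \<Rightarrow> point \<Rightarrow> point \<Rightarrow> point" where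
  "X36 P Q R = circle_inverse (circumcenter P Q R) (circumradius P Q R) (incenter P Q R)"

definition locus ::
  "(point \<Rightarrow> point \<Rightarrow> point \<Rightarrow> point) \<Rightarrow> (point \<times> point \<times> point) set \<Rightarrow> point set" where
  "locus X T = {X P Q R | P Q R. (P, Q, R) \<in> T}"

end

theory Submission
  imports Defs "HOL-Computational_Algebra.Fundamental_Theorem_Algebra"
begin

text \<open>Identify the plane with the complex numbers so that the common incircle becomes the unit
  circle, and describe a triangle by the touch points \<open>u, v, w\<close> of its sides: its vertices are
  the poles \<open>2uv/(u+v)\<close>, \<open>2vw/(v+w)\<close>, \<open>2wu/(w+u)\<close>. They lie on the ellipse exactly when
  \<open>u + v + w = h + m uvw\<close>, with \<open>h\<close> and the real \<open>m\<close> read off the equation of the ellipse, and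
  \<open>4B = 1 + m\<^sup>2 - \<bar>h\<bar>\<^sup>2\<close>, which determines the radius. Conversely, the cubic
  \<open>z\<^sup>3 - (h + ml)z\<^sup>2 + (m + l cnj h)z - l\<close> has three distinct unimodular roots for every unimodular
  \<open>l\<close> since \<open>\<bar>h\<bar> < 1 - m\<close>. Inversion in the incircle maps the circumcircle to the nine-point
  circle of the touch triangle, whose center is \<open>(u + v + w)/2\<close>; so \<open>X36\<close> corresponds to
  \<open>2 / cnj (u + v + w)\<close>, and its locus is the inverse of the circle with center \<open>h\<close> and radius
  \<open>m\<close>.\<close>

section \<open>Poles of chords of the unit circle on a conic\<close>

text \<open>The tangents to the unit circle at unimodular \<open>u\<close> and \<open>v\<close> meet
  here. Antipodal touch points have parallel tangents, and division by zero then returns 0; hence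
  the recurring hypotheses that \<open>u + v\<close> is nonzero.\<close>

definition pole :: "complex \<Rightarrow> complex \<Rightarrow> complex" where
  "pole u v = 2 * u * v / (u + v)"

lemma unimodular_mult_cnj: "cmod u = 1 \<Longrightarrow> u * cnj u = 1"
  using complex_norm_square[of u] by simp

lemma unimodular_cnj: "cmod u = 1 \<Longrightarrow> cnj u = 1 / u"
  using unimodular_mult_cnj[of u] by (cases "u = 0") (auto simp: field_simps)

lemma unimodular_nonzero: "cmod u = 1 \<Longrightarrow> u \<noteq> 0"
  by auto

lemma cnj_pole:
  assumes "cmod u = 1" "cmod v = 1"
  shows "cnj (pole u v) = 2 / (u + v)"
proof (cases "u + v = 0")
  case False
  then have "v + u \<noteq> 0" by (simp add: add.commute)
  moreover have "u \<noteq> 0" "v \<noteq> 0" using assms by auto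
  ultimately show ?thesis
    using False by (simp add: pole_def unimodular_cnj[OF assms(1)] unimodular_cnj[OF assms(2)] divide_simps)
qed (simp add: pole_def)

lemma pole_commute: "pole u v = pole v u"
  by (simp add: pole_def add.commute mult.commute mult.left_commute)

lemma pole_eq_iff:
  assumes "u \<noteq> 0" "v \<noteq> 0" "w \<noteq> 0" "u + v \<noteq> 0" "v + w \<noteq> 0"
  shows "pole u v = pole v w \<longleftrightarrow> u = w"
proof
  assume "pole u v = pole v w"
  then have "v * (v * (u - w)) = 0"
    using assms by (simp add: pole_def field_simps)
  then show "u = w" using assms by simp
qed (simp add: pole_commute)

text \<open>An axis-parallel conic scaled to the value 1 at the origin: the coefficients of x^2 and
  y^2 are m/2 - B and -m/2 - B, and \<open>h\<close> carries the linear terms.\<close>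

definition conic :: "real \<Rightarrow> real \<Rightarrow> complex \<Rightarrow> complex \<Rightarrow> real" where
  "conic m B h z = 1 - Re (cnj h * z) + m / 2 * Re (z\<^sup>2) - B * (cmod z)\<^sup>2"

text \<open>If z is the pole, then z (u + v) = 2uv and \<open>cnj z\<close> (u + v) = 2. Clearing
  denominators thus removes all conjugates of touch points and leaves a polynomial of degree two in
  each of \<open>u\<close> and \<open>v\<close>.\<close>

lemma conic_pole:
  assumes "cmod u = 1" "cmod v = 1" "u + v \<noteq> 0"
  shows "of_real (conic m B h (pole u v)) * (u + v)\<^sup>2 =
    (u + v)\<^sup>2 - (cnj h * (u * v) + h) * (u + v) + of_real m * ((u * v)\<^sup>2 + 1)
      - of_real (4 * B) * (u * v)"
proof -
  define z where "z = pole u v"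
  have Re: "complex_of_real (Re x) = (x + cnj x) / 2" for x
    by (simp add: complex_add_cnj)
  have z: "z * (u + v) = 2 * (u * v)" "cnj z * (u + v) = 2"
    unfolding z_def cnj_pole[OF assms(1,2)]
    by (simp_all only: pole_def nonzero_divide_eq_eq[OF assms(3)] times_divide_eq_left)
      (simp_all add: assms(3) nonzero_divide_eq_eq algebra_simps)
  have c: "complex_of_real (conic m B h z) =
      1 - (cnj h * z + h * cnj z) / 2 + of_real m / 2 * ((z\<^sup>2 + (cnj z)\<^sup>2) / 2) - of_real B * (z * cnj z)"
    unfolding conic_def of_real_diff of_real_add of_real_mult Re complex_norm_square by simp
  have e: "of_real (conic m B h z) * (u + v)\<^sup>2 =
      (u + v)\<^sup>2 - (cnj h * (z * (u + v)) + h * (cnj z * (u + v))) / 2 * (u + v)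
        + of_real m / 4 * ((z * (u + v))\<^sup>2 + (cnj z * (u + v))\<^sup>2)
        - of_real B * ((z * (u + v)) * (cnj z * (u + v)))"
    unfolding c by (simp add: field_simps power2_eq_square)
  show ?thesis
    unfolding z_def[symmetric] e z by (simp add: field_simps power2_eq_square)
qed

text \<open>Vieta's formulas without division by \<open>A\<close>, which may vanish.\<close>

lemma quadratic_roots_sum_prod:
  fixes A :: "'a::idom"
  assumes "A * x\<^sup>2 + L * x + K = 0" "A * y\<^sup>2 + L * y + K = 0" "x \<noteq> y"
  shows "A * (x + y) = - L" "A * (x * y) = K"
proof -
  have "(x - y) * (A * (x + y) + L) = 0"
    using assms(1,2) by (simp add: algebra_simps power2_eq_square)
      (metis add.commute add_right_imp_eq)
  then have *: "A * (x + y) + L = 0" using assms(3) by simp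
  then show "A * (x + y) = - L" by (simp add: eq_neg_iff_add_eq_0)
  then have L: "L = - (A * (x + y))" by simp
  have "K = - (A * x\<^sup>2 + L * x)" using assms(1) by (metis eq_neg_iff_add_eq_0 add.commute)
  then show "A * (x * y) = K" unfolding L by (simp add: algebra_simps power2_eq_square)
qed

text \<open>Divided differences: the two of first order vanish, and their difference is (u - w)(u +
  v + w - s).\<close>

lemma cubic_roots_sum:
  fixes s :: "'a::idom"
  assumes roots: "\<And>x. x \<in> {u, v, w} \<Longrightarrow> x^3 - s * x\<^sup>2 + t * x - p = 0"
    and "u \<noteq> v" "v \<noteq> w" "u \<noteq> w"
  shows "u + v + w = s"
proof -
  have "(u - v) * (u\<^sup>2 + u * v + v\<^sup>2 - s * (u + v) + t) =
      (u^3 - s * u\<^sup>2 + t * u - p) - (v^3 - s * v\<^sup>2 + t * v - p)"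
    "(v - w) * (v\<^sup>2 + v * w + w\<^sup>2 - s * (v + w) + t) =
      (v^3 - s * v\<^sup>2 + t * v - p) - (w^3 - s * w\<^sup>2 + t * w - p)"
    by (simp_all add: algebra_simps power2_eq_square power3_eq_cube)
  then have 1: "u\<^sup>2 + u * v + v\<^sup>2 - s * (u + v) + t = 0" "v\<^sup>2 + v * w + w\<^sup>2 - s * (v + w) + t = 0"
    using roots[of u] roots[of v] roots[of w] assms(2,3) by simp_all
  have "(u - w) * (u + v + w - s) =
      (u\<^sup>2 + u * v + v\<^sup>2 - s * (u + v) + t) - (v\<^sup>2 + v * w + w\<^sup>2 - s * (v + w) + t)"
    by (simp add: algebra_simps power2_eq_square)
  then show ?thesis using 1 assms(4) by simp
qed

lemma conic_pole_eq_0_iff: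
  assumes "cmod u = 1" "cmod v = 1" "u + v \<noteq> 0"
  shows "conic m B h (pole u v) = 0 \<longleftrightarrow>
    (u + v)\<^sup>2 - (cnj h * (u * v) + h) * (u + v) + of_real m * ((u * v)\<^sup>2 + 1)
      - of_real (4 * B) * (u * v) = 0"
  unfolding conic_pole[OF assms, symmetric] using assms(3) by simp

text \<open>With one touch point fixed, the other two are the roots of one quadratic. Vieta's
  product formula, multiplied by the fixed point, is the same cubic for all three points, and its
  quadratic coefficient gives their sum. Vieta's sum formula then yields the relation for
  \<open>B\<close>.\<close>

lemma sum_touch_points:
  assumes uni: "cmod u = 1" "cmod v = 1" "cmod w = 1"
    and dist: "u \<noteq> v" "v \<noteq> w" "u \<noteq> w"
    and nonanti: "u + v \<noteq> 0" "v + w \<noteq> 0" "w + u \<noteq> 0"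
    and on: "conic m B h (pole u v) = 0" "conic m B h (pole v w) = 0" "conic m B h (pole w u) = 0"
  shows "u + v + w = h + of_real m * (u * v * w)"
    and "4 * B = 1 + m\<^sup>2 - (cmod h)\<^sup>2"
proof -
  \<comment> \<open>The coefficients, as functions of \<open>y\<close>, of the pole relation for
    \<open>x\<close> and \<open>y\<close> regarded as a quadratic in \<open>x\<close>.\<close>
  let ?A = "\<lambda>x. 1 - cnj h * x + of_real m * x\<^sup>2"
  let ?L = "\<lambda>x. 2 * x - cnj h * x\<^sup>2 - h - of_real (4 * B) * x"
  let ?K = "\<lambda>x. x\<^sup>2 - h * x + of_real m"
  have quad: "?A y * x\<^sup>2 + ?L y * x + ?K y = 0"
    if "cmod x = 1" "cmod y = 1" "x + y \<noteq> 0" "conic m B h (pole x y) = 0" for x y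
    using that(4) unfolding conic_pole_eq_0_iff[OF that(1-3)]
    by (simp add: algebra_simps power2_eq_square)
  have quads: "?A y * x\<^sup>2 + ?L y * x + ?K y = 0" if "(x, y) \<in> {(u,v),(v,u),(v,w),(w,v),(w,u),(u,w)}" for x y
    using that quad uni nonanti on by (auto simp: add.commute pole_commute)
  have prod: "?A y * (x * z) = ?K y" and sum: "?A y * (x + z) = - ?L y"
    if "(x, y, z) \<in> {(u,v,w),(v,w,u),(w,u,v)}" for x y z
    using that quadratic_roots_sum_prod[of "?A y" x "?L y" "?K y" z] quads dist by auto
  have cubic: "x^3 - (h + of_real m * (u * v * w)) * x\<^sup>2 + (of_real m + (u * v * w) * cnj h) * x - u * v * w = 0"
    if "x \<in> {u, v, w}" for x
  proof -
    have "?A x * (u * v * w) = ?K x * x"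
      using that prod[of u v w] prod[of v w u] prod[of w u v]
      by (auto simp: mult.assoc[symmetric]) (metis mult.assoc mult.commute)+
    then show ?thesis by (simp add: algebra_simps power2_eq_square power3_eq_cube)
  qed
  show S: "u + v + w = h + of_real m * (u * v * w)"
    by (rule cubic_roots_sum[OF cubic]) (use dist in auto)
  \<comment> \<open>Eliminating \<open>u + w\<close> by the first claim and \<open>u * w\<close> by
    the product formula leaves v (1 + m^2 - |h|^2 - 4B) = 0.\<close>
  have "?A v * (u * w) = ?K v" "?A v * (u + w) = - ?L v" using prod[of u v w] sum[of u v w] by auto
  moreover have "u + w = h + of_real m * v * (u * w) - v" using S by (simp add: algebra_simps)
  ultimately have "?A v * (h + of_real m * v * (u * w) - v) = - ?L v" by simp
  then have "?A v * (h - v) + of_real m * v * (?A v * (u * w)) + ?L v = 0"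
    by (simp only: right_diff_distrib distrib_left) (simp add: algebra_simps)
  then have "?A v * (h - v) + of_real m * v * ?K v + ?L v = 0"
    using prod[of u v w] by simp
  moreover have "?A v * (h - v) + of_real m * v * ?K v + ?L v =
      v * (1 + (of_real m)\<^sup>2 - h * cnj h - of_real (4 * B))"
    by (simp add: algebra_simps power2_eq_square)
  ultimately have "v * (1 + (of_real m)\<^sup>2 - h * cnj h - of_real (4 * B)) = 0" by simp
  then have "complex_of_real (1 + m\<^sup>2 - (cmod h)\<^sup>2 - 4 * B) = 0"
    using uni(2) by (auto simp flip: complex_norm_square)
  then have "1 + m\<^sup>2 - (cmod h)\<^sup>2 - 4 * B = 0" using of_real_eq_0_iff by blast
  then show "4 * B = 1 + m\<^sup>2 - (cmod h)\<^sup>2" by simp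
qed

text \<open>The sum equation and its conjugate are both linear in \<open>w\<close>; eliminating
  \<open>w\<close> between them gives exactly the pole relation for \<open>u\<close> and
  \<open>v\<close>.\<close>

lemma conic_pole_of_sum:
  assumes uni: "cmod u = 1" "cmod v = 1" "cmod w = 1" and nonanti: "u + v \<noteq> 0"
    and S: "u + v + w = h + of_real m * (u * v * w)"
    and B: "4 * B = 1 + m\<^sup>2 - (cmod h)\<^sup>2"
  shows "conic m B h (pole u v) = 0"
proof -
  have [simp]: "u \<noteq> 0" "v \<noteq> 0" "w \<noteq> 0" using uni by auto
  define s q where sq: "s = u + v" "q = u * v"
  have B': "of_real (4 * B) = 1 + (of_real m)\<^sup>2 - h * cnj h"
    unfolding B by (simp flip: complex_norm_square)
  have "cnj (u + v + w) = cnj (h + of_real m * (u * v * w))" using S by simp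
  then have "1 / u + 1 / v + 1 / w = cnj h + of_real m / (u * v * w)"
    by (simp add: unimodular_cnj[OF uni(1)] unimodular_cnj[OF uni(2)] unimodular_cnj[OF uni(3)])
  then have "w * (s - q * cnj h) = of_real m - q"
    by (simp add: sq field_simps)
  moreover have "w * (1 - of_real m * q) = h - s" using S by (simp add: sq algebra_simps)
  ultimately have "w * ((h - s) * (s - q * cnj h)) = w * ((of_real m - q) * (1 - of_real m * q))"
    by (metis mult.commute mult.left_commute)
  then have "(h - s) * (s - q * cnj h) = (of_real m - q) * (1 - of_real m * q)" by simp
  then show ?thesis
    unfolding conic_pole_eq_0_iff[OF uni(1,2) nonanti] B' sq[symmetric]
    by (simp add: algebra_simps power2_eq_square)
qed

section \<open>Roots of the cubic of touch points\<close>

lemma unimodular_root: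
  assumes m: "0 \<le> m" "cmod h < 1 - m" and l: "cmod l = 1"
    and root: "z^3 - (h + of_real m * l) * z\<^sup>2 + (of_real m + l * cnj h) * z - l = 0"
  shows "cmod z = 1"
proof -
  \<comment> \<open>The cubic says z q = l p, where p is the conjugate reciprocal polynomial of q.
    Hence |z| |q| = |p|, and comparison with \<open>id\<close> gives 1 - |z|^2 times a positive
    factor equal to 0.\<close>
  let ?q = "z\<^sup>2 - h * z + of_real m" and ?p = "1 - cnj h * z + of_real m * z\<^sup>2"
  define t where "t = cmod z"
  have m1: "m < 1" using m norm_ge_zero[of h] by linarith
  have "z * ?q = l * ?p" using root by (simp add: algebra_simps power2_eq_square power3_eq_cube)
  then have "cmod (z * ?q) = cmod (l * ?p)" by simp
  then have eq: "t * cmod ?q = cmod ?p" by (simp only: norm_mult l t_def)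
  \<comment> \<open>The difference has the sign of \<open>1 - \<bar>z\<bar>\<close>, as for a Blaschke product.\<close>
  have id: "(cmod ?p)\<^sup>2 - (cmod ?q)\<^sup>2 =
      (1 - t\<^sup>2) * ((1 - m\<^sup>2) * (1 + t\<^sup>2) - 2 * Re (cnj (h - of_real m * cnj h) * z))"
  proof -
    have *: "t\<^sup>2 = (Re z)\<^sup>2 + (Im z)\<^sup>2" by (simp add: t_def cmod_power2)
    show ?thesis unfolding * cmod_power2
      by (simp add: power2_eq_square) algebra
  qed
  \<comment> \<open>Since |h - m cnj h| <= (1 + m) |h| <= 1 - m^2, this reduces to 2t <= 1 +
    t^2.\<close>
  have bd: "2 * Re (cnj (h - of_real m * cnj h) * z) \<le> (1 - m\<^sup>2) * (1 + t\<^sup>2)"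
  proof -
    have "Re (cnj (h - of_real m * cnj h) * z) \<le> cmod (h - of_real m * cnj h) * t"
      unfolding t_def by (metis complex_Re_le_cmod complex_mod_cnj norm_mult)
    also have "cmod (h - of_real m * cnj h) \<le> cmod h + m * cmod h"
      using norm_triangle_ineq4[of h "of_real m * cnj h"] m by (simp add: norm_mult)
    also have "\<dots> = (1 + m) * cmod h" by (simp add: algebra_simps)
    also have "\<dots> \<le> (1 + m) * (1 - m)" using m by (intro mult_left_mono) auto
    also have "\<dots> = 1 - m\<^sup>2" by (simp add: algebra_simps power2_eq_square)
    finally have "Re (cnj (h - of_real m * cnj h) * z) \<le> (1 - m\<^sup>2) * t"
      by (simp add: t_def mult_right_mono)
    moreover have "(1 - m\<^sup>2) * (2 * t) \<le> (1 - m\<^sup>2) * (1 + t\<^sup>2)"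
    proof (rule mult_left_mono)
      show "2 * t \<le> 1 + t\<^sup>2" using zero_le_power2[of "t - 1"] by (simp add: power2_diff)
      show "0 \<le> 1 - m\<^sup>2" using m m1 by (simp add: power_le_one)
    qed
    ultimately show ?thesis by (simp add: algebra_simps)
  qed
  \<comment> \<open>A zero of q would also be a zero of p. The triangle inequality applied to p
    excludes |z| <= 1, and applied to q it excludes |z| > 1.\<close>
  have q0: "?q \<noteq> 0"
  proof
    assume q: "?q = 0"
    then have p: "?p = 0" using eq by simp
    have "cmod (h * z - of_real m) = cmod (z\<^sup>2)" using q by (metis add_diff_cancel_left' diff_add_cancel diff_diff_eq2 eq_iff_diff_eq_0)
    then have 1: "t\<^sup>2 \<le> cmod h * t + m"
      using norm_triangle_ineq4[of "h * z" "of_real m"] m by (simp add: norm_mult norm_power t_def)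
    have "cmod (cnj h * z - of_real m * z\<^sup>2) = 1" using p by (metis diff_add_eq diff_diff_eq2 eq_iff_diff_eq_0 norm_one)
    then have 2: "1 \<le> cmod h * t + m * t\<^sup>2"
      using norm_triangle_ineq4[of "cnj h * z" "of_real m * z\<^sup>2"] m by (simp add: norm_mult norm_power t_def)
    have t0: "0 \<le> t" by (simp add: t_def)
    show False
    proof (cases "t \<le> 1")
      case True
      have "cmod h * t \<le> cmod h * 1" using True by (intro mult_left_mono) simp_all
      moreover have "m * t\<^sup>2 \<le> m * 1" using True t0 m by (intro mult_left_mono power_le_one) simp_all
      ultimately show False using 2 m by simp
    next
      case False
      have tt: "1 < t\<^sup>2" using False by (intro one_less_power) simp_all
      have "t * 1 \<le> t * t" using False by (intro mult_left_mono) simp_all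
      then have "cmod h * t \<le> cmod h * t\<^sup>2" by (intro mult_left_mono) (simp_all add: power2_eq_square)
      moreover have "m * 1 \<le> m * t\<^sup>2" using tt m by (intro mult_left_mono) simp_all
      moreover have "(cmod h + m) * t\<^sup>2 < 1 * t\<^sup>2" using m tt by (intro mult_strict_right_mono) auto
      ultimately show False using 1 by (simp add: algebra_simps)
    qed
  qed
  have t0: "0 \<le> t" by (simp add: t_def)
  have qpos: "0 < (cmod ?q)\<^sup>2" using q0 by simp
  have "(cmod ?p)\<^sup>2 - (cmod ?q)\<^sup>2 = - (1 - t\<^sup>2) * (cmod ?q)\<^sup>2"
    unfolding eq[symmetric] by (simp add: algebra_simps power_mult_distrib)
  with id have "(1 - t\<^sup>2) * (((1 - m\<^sup>2) * (1 + t\<^sup>2) - 2 * Re (cnj (h - of_real m * cnj h) * z)) + (cmod ?q)\<^sup>2) = 0"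
    by (simp add: algebra_simps)
  then have "1 - t\<^sup>2 = 0" using bd qpos by (simp only: mult_eq_0_iff) linarith
  then have "t = 1" using t0 by (simp add: power2_eq_1_iff)
  then show ?thesis by (simp add: t_def)
qed

lemma quadratic_factor:
  fixes s q :: complex
  obtains v w where "v + w = s" "v * w = q"
proof -
  define d where "d = csqrt (s\<^sup>2 - 4 * q)"
  have "d\<^sup>2 = s\<^sup>2 - 4 * q" by (simp add: d_def)
  then have "(s + d) / 2 * ((s - d) / 2) = q" by (simp add: field_simps power2_eq_square)
  moreover have "(s + d) / 2 + (s - d) / 2 = s" by (simp add: field_simps)
  ultimately show ?thesis using that by blast
qed

text \<open>The touch points are the roots of the cubic in \<open>unimodular_root\<close>: one comes
  from the fundamental theorem of algebra, the other two from the remaining quadratic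
  factor.\<close>

lemma touch_points_exist:
  assumes m: "0 \<le> m" "cmod h < 1 - m" and l: "cmod l = 1"
  obtains u v w where "cmod u = 1" "cmod v = 1" "cmod w = 1"
    "u + v + w = h + of_real m * l" "u * v * w = l"
    "u \<noteq> v" "v \<noteq> w" "u \<noteq> w" "u + v \<noteq> 0" "v + w \<noteq> 0" "w + u \<noteq> 0"
proof -
  define S T where ST: "S = h + of_real m * l" "T = of_real m + l * cnj h"
  have "\<not> constant (poly [:- l, T, - S, 1:])"
    by (simp add: constant_degree)
  then obtain u where "poly [:- l, T, - S, 1:] u = 0"
    using fundamental_theorem_of_algebra by blast
  then have u: "u^3 - S * u\<^sup>2 + T * u - l = 0"
    by (simp add: algebra_simps power2_eq_square power3_eq_cube)
  obtain v w where vw: "v + w = S - u" "v * w = T - u * (S - u)"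
    by (rule quadratic_factor)
  have fac: "(z - u) * (z - v) * (z - w) = z^3 - S * z\<^sup>2 + T * z - l" for z
  proof -
    have "(z - u) * (z - v) * (z - w) = (z - u) * (z\<^sup>2 - (v + w) * z + v * w)"
      by (simp add: algebra_simps power2_eq_square)
    also have "\<dots> = (z^3 - S * z\<^sup>2 + T * z - l) - (u^3 - S * u\<^sup>2 + T * u - l)"
      unfolding vw by (simp add: algebra_simps power2_eq_square power3_eq_cube)
    finally show ?thesis using u by simp
  qed
  have uni: "cmod z = 1" if "z \<in> {u, v, w}" for z
    using fac[of z] that unimodular_root[OF m l, of z] unfolding ST by auto
  have sum: "u + v + w = h + of_real m * l" using vw(1) by (simp add: ST algebra_simps)
  have prod: "u * v * w = l" using fac[of 0] by simp
  \<comment> \<open>A repeated root or an antipodal pair would force \<open>\<bar>h\<bar> \<ge> 1 - m\<close>.\<close>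
  have key: "x \<noteq> y \<and> x + y \<noteq> 0"
    if "x + y + z = h + of_real m * l" "x * y * z = l" "cmod x = 1" "cmod y = 1" "cmod z = 1" for x y z
  proof -
    have m': "cmod (1 - of_real m * x * y) \<le> 1 + m"
      using norm_triangle_ineq4[of 1 "of_real m * x * y"] m that by (simp add: norm_mult)
    have m'': "1 - m \<le> cmod (1 - of_real m * x * y)"
      using norm_triangle_ineq2[of 1 "of_real m * x * y"] m that by (simp add: norm_mult)
    have h: "h = (x + y) + z * (1 - of_real m * x * y)"
      using that(1) unfolding that(2)[symmetric] by (simp add: algebra_simps)
    have "x \<noteq> y"
    proof
      assume "x = y"
      then have "cmod h \<ge> 2 - cmod (1 - of_real m * x * y)"
        using norm_diff_ineq[of "x + y" "z * (1 - of_real m * x * y)"] that h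
        by (simp add: norm_mult flip: mult_2)
      then show False using m m' by linarith
    qed
    moreover have "x + y \<noteq> 0"
    proof
      assume "x + y = 0"
      then have "cmod h = cmod (1 - of_real m * x * y)" using h that by (simp add: norm_mult)
      then show False using m m'' by linarith
    qed
    ultimately show ?thesis by simp
  qed
  have "v + w + u = h + of_real m * l" "w + u + v = h + of_real m * l" "v * w * u = l" "w * u * v = l"
    using sum prod by (simp_all add: add_ac mult_ac)
  then have "u \<noteq> v \<and> u + v \<noteq> 0" "v \<noteq> w \<and> v + w \<noteq> 0" "w \<noteq> u \<and> w + u \<noteq> 0"
    using uni sum prod key[of u v w] key[of v w u] key[of w u v] by blast+
  then show ?thesis using that[of u v w] uni sum prod by auto
qed

text \<open>The map s -> 2 / cnj s is inversion in the circle of radius sqrt 2 about 0. As |h|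
  differs from m, the given circle avoids 0 and its image is a circle rather than a line. One
  inclusion rests on N - h cnj s = - m cnj l s, the other on a factor N of the squared circle
  equation.\<close>

lemma inverted_circle:
  assumes m: "0 < m" and N: "(cmod h)\<^sup>2 \<noteq> m\<^sup>2"
  shows "{2 / cnj (h + of_real m * l) | l. cmod l = 1} =
    sphere (2 * h / of_real ((cmod h)\<^sup>2 - m\<^sup>2)) (2 * m / \<bar>(cmod h)\<^sup>2 - m\<^sup>2\<bar>)"
proof -
  define N where "N = (cmod h)\<^sup>2 - m\<^sup>2"
  have N0: "N \<noteq> 0" using assms by (simp add: N_def)
  have Nc: "complex_of_real N = h * cnj h - (of_real m)\<^sup>2" by (simp add: N_def flip: complex_norm_square)
  have mem: "z \<in> sphere (2 * h / of_real N) (2 * m / \<bar>N\<bar>) \<longleftrightarrow> cmod (of_real N * z - 2 * h) = 2 * m" for z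
  proof -
    have "of_real N * z - 2 * h = of_real N * (z - 2 * h / of_real N)"
      using N0 by (simp add: field_simps)
    then have "cmod (of_real N * z - 2 * h) = \<bar>N\<bar> * dist (2 * h / of_real N) z"
      by (simp add: dist_norm norm_mult norm_minus_commute)
    then show ?thesis using N0 by (auto simp: field_simps)
  qed
  have "{2 / cnj (h + of_real m * l) | l. cmod l = 1} = sphere (2 * h / of_real N) (2 * m / \<bar>N\<bar>)"
  proof (intro set_eqI iffI)
    fix z assume "z \<in> {2 / cnj (h + of_real m * l) | l. cmod l = 1}"
    then obtain l where l: "cmod l = 1" and z: "z = 2 / cnj (h + of_real m * l)" by blast
    define s where "s = h + of_real m * l"
    have s0: "s \<noteq> 0"
    proof
      assume "s = 0"
      then have "h = - (of_real m * l)" by (simp add: s_def eq_neg_iff_add_eq_0)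
      then have "cmod h = m" using l m by (simp add: norm_mult)
      with assms show False by simp
    qed
    have "of_real N - h * cnj s = - (of_real m * cnj l * s)"
      using unimodular_mult_cnj[OF l] by (simp add: Nc s_def algebra_simps power2_eq_square)
    then have "cmod (of_real N - h * cnj s) = m * cmod s" using l m by (simp add: norm_mult)
    moreover have "of_real N * z - 2 * h = 2 * (of_real N - h * cnj s) / cnj s"
      unfolding z s_def[symmetric] using s0 by (simp add: field_simps)
    ultimately have "cmod (of_real N * z - 2 * h) = 2 * m"
      using s0 by (simp only: norm_mult norm_divide) simp
    then show "z \<in> sphere (2 * h / of_real N) (2 * m / \<bar>N\<bar>)" by (simp only: mem)
  next
    fix z assume "z \<in> sphere (2 * h / of_real N) (2 * m / \<bar>N\<bar>)"
    then have "cmod (of_real N * z - 2 * h) = 2 * m" by (simp only: mem)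
    then have "(cmod (of_real N * z - 2 * h))\<^sup>2 = 4 * m\<^sup>2" by (simp add: power_mult_distrib)
    moreover have "(cmod (of_real N * z - 2 * h))\<^sup>2 - 4 * m\<^sup>2
        = N * ((cmod (2 - h * cnj z))\<^sup>2 - m\<^sup>2 * (cmod z)\<^sup>2)"
    proof -
      have N: "N = (Re h)\<^sup>2 + (Im h)\<^sup>2 - m\<^sup>2" by (simp add: N_def cmod_power2)
      show ?thesis unfolding cmod_power2 N by (simp add: algebra_simps power2_eq_square)
    qed
    ultimately have "(cmod (2 - h * cnj z))\<^sup>2 = (m * cmod z)\<^sup>2" using N0 by (simp add: power_mult_distrib)
    then have eq: "cmod (2 - h * cnj z) = m * cmod z" using m by simp
    have z0: "z \<noteq> 0" using eq by auto
    define l where "l = (2 / cnj z - h) / of_real m"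
    have "l = (2 - h * cnj z) / (of_real m * cnj z)" using z0 m by (simp add: l_def field_simps)
    then have "cmod l = 1" using eq z0 m by (simp add: norm_divide norm_mult)
    moreover have "z = 2 / cnj (h + of_real m * l)" using m z0 by (simp add: l_def)
    ultimately show "z \<in> {2 / cnj (h + of_real m * l) | l. cmod l = 1}" by blast
  qed
  then show ?thesis by (simp add: N_def)
qed

section \<open>Triangles circumscribed about a circle\<close>

text \<open>Coordinates in which the circle with center \<open>C\<close> and radius \<open>r\<close>
  becomes the unit circle; lengths are scaled by \<open>r\<close>.\<close>

definition embed :: "point \<Rightarrow> real \<Rightarrow> complex \<Rightarrow> point" where
  "embed C r z = (fst C + r * Re z, snd C + r * Im z)"

lemma embed_0 [simp]: "embed C r 0 = C"
  by (simp add: embed_def)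

lemma dist_embed: "0 \<le> r \<Longrightarrow> dist (embed C r z) (embed C r w) = r * dist z w"
proof -
  assume r: "0 \<le> r"
  have "(r * Re z - r * Re w)\<^sup>2 + (r * Im z - r * Im w)\<^sup>2 = r\<^sup>2 * ((Re z - Re w)\<^sup>2 + (Im z - Im w)\<^sup>2)"
    by (simp add: algebra_simps power2_eq_square)
  then show ?thesis
    using r by (simp add: embed_def dist_Pair_Pair dist_real_def dist_norm[of z w] cmod_def real_sqrt_mult)
qed

lemma embed_inject: "r \<noteq> 0 \<Longrightarrow> embed C r z = embed C r w \<longleftrightarrow> z = w"
  by (auto simp: embed_def complex_eq_iff)

lemma embed_surj:
  assumes "r \<noteq> 0" obtains z where "X = embed C r z"
proof
  show "X = embed C r (Complex ((fst X - fst C) / r) ((snd X - snd C) / r))"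
    using assms by (simp add: embed_def)
qed

lemma embed_add_scaled:
  "embed C r z + t *\<^sub>R (embed C r x - embed C r y) = embed C r (z + of_real t * (x - y))"
  by (simp add: embed_def algebra_simps)

lemma embed_in_sphere: "0 < r \<Longrightarrow> embed C r z \<in> sphere C r \<longleftrightarrow> cmod z = 1"
  using dist_embed[of r C 0 z] by (simp add: mult_cancel_left1)

lemma affine_hull_embed:
  "affine hull {embed C r p, embed C r q} = {embed C r (p + of_real t * (q - p)) | t. True}"
proof -
  have "affine hull {embed C r p, embed C r q} =
      {embed C r p + t *\<^sub>R (embed C r q - embed C r p) | t. True}"
    by (auto simp: affine_hull_2_alt)
  then show ?thesis by (simp add: embed_add_scaled)
qed

text \<open>The real part of z cnj v is the inner product of z and v, here 1. The imaginary part is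
  the signed length from the touch point along the tangent.\<close>

lemma tangent_point:
  assumes "cmod v = 1" "z \<bullet> v = 1"
  shows "z = v * (1 + \<i> * of_real (Im (z * cnj v)))"
proof -
  have "1 + \<i> * of_real (Im (z * cnj v)) = z * cnj v"
    using assms(2) by (simp add: complex_eq_iff inner_complex_def)
  then show ?thesis using unimodular_mult_cnj[OF assms(1)] by (simp add: mult.left_commute)
qed

text \<open>Replaces the condition of a single common point by a linear tangent equation. Uniqueness
  of the common point forces q - p to be orthogonal to v. Conversely, a common point z satisfies |z
  - v|^2 = 1 - 2 + 1 = 0.\<close>

lemma tangent_to_circle_embed:
  assumes r: "0 < r" and pq: "p \<noteq> q"
  shows "tangent_to_circle (affine hull {embed C r p, embed C r q}) C r \<longleftrightarrow>
    (\<exists>v. cmod v = 1 \<and> p \<bullet> v = 1 \<and> q \<bullet> v = 1)"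
proof -
  let ?l = "\<lambda>t. p + of_real t * (q - p)"
  have mem: "embed C r z \<in> affine hull {embed C r p, embed C r q} \<inter> sphere C r
      \<longleftrightarrow> (\<exists>t. z = ?l t) \<and> cmod z = 1" for z
    using r embed_in_sphere[OF r, of C z] by (auto simp: affine_hull_embed embed_inject)
  show ?thesis
  proof
    assume "tangent_to_circle (affine hull {embed C r p, embed C r q}) C r"
    then obtain X where X: "X \<in> affine hull {embed C r p, embed C r q} \<inter> sphere C r"
      and uniq: "\<And>Y. Y \<in> affine hull {embed C r p, embed C r q} \<inter> sphere C r \<Longrightarrow> Y = X"
      unfolding tangent_to_circle_def by blast
    obtain v where Xv: "X = embed C r v" using r by (metis embed_surj less_irrefl)
    obtain t where t: "v = ?l t" and v1: "cmod v = 1" using X unfolding Xv mem by blast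
    define d where "d = q - p"
    have dd: "d \<bullet> d \<noteq> 0" using pq by (simp add: d_def)
    \<comment> \<open>the second intersection point, obtained by reflection\<close>
    define c where "c = - 2 * (v \<bullet> d) / (d \<bullet> d)"
    have vv: "v \<bullet> v = 1" using v1 by (simp add: dot_square_norm)
    have "(v + c *\<^sub>R d) \<bullet> (v + c *\<^sub>R d) = v \<bullet> v + c * (2 * (v \<bullet> d) + c * (d \<bullet> d))"
      by (simp add: inner_add_left inner_add_right inner_commute algebra_simps)
    also have "2 * (v \<bullet> d) + c * (d \<bullet> d) = 0" using dd by (simp add: c_def)
    finally have "cmod (v + c *\<^sub>R d) = 1" using vv by (simp add: norm_eq_sqrt_inner)
    moreover have "v + c *\<^sub>R d = ?l (t + c)"
      unfolding t d_def by (simp add: scaleR_conv_of_real algebra_simps)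
    ultimately have "embed C r (v + c *\<^sub>R d) = embed C r v"
      using uniq mem Xv by blast
    then have "c *\<^sub>R d = 0" using r by (simp add: embed_inject)
    then have vd: "v \<bullet> d = 0" using dd by (auto simp: c_def)
    have "p = v - t *\<^sub>R d" unfolding t d_def by (simp add: scaleR_conv_of_real)
    then have "p \<bullet> v = 1" using vv vd by (simp add: inner_diff_left inner_diff_right inner_commute)
    moreover have "q \<bullet> v = p \<bullet> v + d \<bullet> v" unfolding d_def by (simp add: inner_diff_left)
    ultimately show "\<exists>v. cmod v = 1 \<and> p \<bullet> v = 1 \<and> q \<bullet> v = 1"
      using v1 vd by (auto simp: inner_commute)
  next
    assume "\<exists>v. cmod v = 1 \<and> p \<bullet> v = 1 \<and> q \<bullet> v = 1"
    then obtain v where v: "cmod v = 1" "p \<bullet> v = 1" "q \<bullet> v = 1" by blast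
    obtain x y where p: "p = v * (1 + \<i> * of_real x)" and q: "q = v * (1 + \<i> * of_real y)"
      using tangent_point[OF v(1,2)] tangent_point[OF v(1,3)] by blast
    have xy: "x \<noteq> y" using p q pq by auto
    \<comment> \<open>The coordinate along the tangent runs affinely from \<open>x\<close> to
      \<open>y\<close>; it vanishes, at the touch point, for this parameter.\<close>
    define t where "t = x / (x - y)"
    have "?l t = v * (1 + \<i> * of_real (x + t * (y - x)))"
      unfolding p q by (simp add: algebra_simps)
    also have "x + t * (y - x) = 0" using xy by (simp add: t_def field_simps)
    finally have "v = ?l t" by simp
    then have 1: "embed C r v \<in> affine hull {embed C r p, embed C r q} \<inter> sphere C r"
      using v(1) mem by blast
    have 2: "Y = embed C r v" if Y: "Y \<in> affine hull {embed C r p, embed C r q} \<inter> sphere C r" for Y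
    proof -
      obtain z where Yz: "Y = embed C r z" using r by (metis embed_surj less_irrefl)
      obtain t where t: "z = ?l t" and z1: "cmod z = 1" using Y unfolding Yz mem by blast
      have "z = p + t *\<^sub>R (q - p)" unfolding t by (simp add: scaleR_conv_of_real)
      then have "z \<bullet> v = 1" using v by (simp add: inner_add_left inner_diff_left)
      moreover have "(z - v) \<bullet> (z - v) = z \<bullet> z - 2 * (z \<bullet> v) + v \<bullet> v"
        by (simp add: inner_diff_left inner_diff_right inner_commute)
      ultimately have "(z - v) \<bullet> (z - v) = 0"
        using z1 v(1) by (simp add: dot_square_norm)
      then show ?thesis by (simp add: Yz)
    qed
    show "tangent_to_circle (affine hull {embed C r p, embed C r q}) C r"
      unfolding tangent_to_circle_def using 1 2 by blast
  qed
qed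

section \<open>Tangent lines and their poles\<close>

lemma inner_eq_1_iff:
  assumes "cmod u = 1"
  shows "p \<bullet> u = 1 \<longleftrightarrow> p + cnj p * u\<^sup>2 = 2 * u"
proof -
  have "complex_of_real (2 * (p \<bullet> u)) = p * cnj u + cnj p * u"
    by (simp add: complex_eq_iff inner_complex_def)
  then have "p \<bullet> u = 1 \<longleftrightarrow> p * cnj u + cnj p * u = 2"
    by (metis mult_cancel_left2 of_real_eq_iff of_real_numeral zero_neq_numeral)
  also have "\<dots> \<longleftrightarrow> p + cnj p * u\<^sup>2 = 2 * u"
    using unimodular_nonzero[OF assms] by (auto simp: unimodular_cnj[OF assms] field_simps power2_eq_square)
  finally show ?thesis .
qed

text \<open>Subtracting the two tangent equations and cancelling u - v gives \<open>cnj p\<close> (u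
  + v) = 2, so u + v is nonzero; substituting back yields p.\<close>

lemma pole_of_tangents:
  assumes "cmod u = 1" "cmod v = 1" "u \<noteq> v" "p \<bullet> u = 1" "p \<bullet> v = 1"
  shows "u + v \<noteq> 0" "p = pole u v"
proof -
  have e: "p + cnj p * u\<^sup>2 = 2 * u" "p + cnj p * v\<^sup>2 = 2 * v"
    using assms inner_eq_1_iff by auto
  then have "(p + cnj p * u\<^sup>2) - (p + cnj p * v\<^sup>2) = 2 * u - 2 * v" by simp
  then have "(u - v) * (cnj p * (u + v)) = (u - v) * 2"
    by (simp add: algebra_simps power2_eq_square)
  then have s: "cnj p * (u + v) = 2" using assms(3) by (metis mult_left_cancel right_minus_eq)
  then show s0: "u + v \<noteq> 0" by auto
  have "p * (u + v) = (p + cnj p * u\<^sup>2) * (u + v) - (cnj p * (u + v)) * u\<^sup>2"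
    by (simp add: algebra_simps)
  also have "\<dots> = 2 * u * v" unfolding e s by (simp add: algebra_simps power2_eq_square)
  finally show "p = pole u v" using s0 by (simp add: pole_def nonzero_eq_divide_eq)
qed

text \<open>The two tangent segments from a point have equal length but opposite orientation around
  the circle, so one \<open>x\<close> serves with both signs.\<close>

lemma pole_tangent:
  assumes "cmod u = 1" "cmod v = 1" "u + v \<noteq> 0"
  obtains x where "pole u v = u * (1 + \<i> * of_real x)" "pole u v = v * (1 - \<i> * of_real x)"
    "pole u v \<bullet> u = 1" "pole u v \<bullet> v = 1"
proof -
  have *: "pole u v \<bullet> u = 1" if "cmod u = 1" "cmod v = 1" "u + v \<noteq> 0" for u v
  proof -
    have "2 * u * v / t + 2 / t * u\<^sup>2 = 2 * u" if "t = u + v" "t \<noteq> 0" for t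
      using that by (simp add: divide_simps) (simp add: algebra_simps power2_eq_square)
    then show ?thesis
      unfolding inner_eq_1_iff[OF that(1)] cnj_pole[OF that(1,2)] using that(3) unfolding pole_def by blast
  qed
  have 1: "pole u v \<bullet> u = 1" "pole u v \<bullet> v = 1"
    using *[OF assms] *[OF assms(2,1)] assms(3) by (simp_all add: pole_commute add.commute)
  define x where "x = Im (pole u v * cnj u)"
  have px: "pole u v = u * (1 + \<i> * of_real x)"
    unfolding x_def by (rule tangent_point[OF assms(1) 1(1)])
  have "u \<noteq> 0" using assms(1) by auto
  have "u * (2 * v) = pole u v * (u + v)"
    using assms(3) by (simp add: pole_def)
  then have "u * (2 * v) = u * ((1 + \<i> * of_real x) * (u + v))"
    using px by (simp add: mult.assoc)
  then have "2 * v = (1 + \<i> * of_real x) * (u + v)"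
    using \<open>u \<noteq> 0\<close> mult_left_cancel by blast
  then have "u * (1 + \<i> * of_real x) = v * (1 - \<i> * of_real x) + (1 + \<i> * of_real x) * (u + v) - 2 * v"
    by (simp add: algebra_simps)
  with \<open>2 * v = _\<close> have "pole u v = v * (1 - \<i> * of_real x)" using px by simp
  with px 1 show ?thesis using that by blast
qed

text \<open>Serves to show that a nondegenerate triangle has distinct touch points: two sides with a
  common touch point would lie on one tangent.\<close>

lemma collinear_tangent_points:
  assumes "cmod v = 1" "p \<bullet> v = 1" "q \<bullet> v = 1" "s \<bullet> v = 1"
  shows "collinear {embed C r p, embed C r q, embed C r s}"
  unfolding collinear_def
proof (intro exI[of _ "(- r * Im v, r * Re v)"] ballI)
  fix X Y assume XY: "X \<in> {embed C r p, embed C r q, embed C r s}" "Y \<in> {embed C r p, embed C r q, embed C r s}"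
  have "\<exists>x. X = embed C r (v * (1 + \<i> * of_real x))" if "X \<in> {embed C r p, embed C r q, embed C r s}" for X
    using that tangent_point[OF assms(1)] assms(2-4) by (metis insertE empty_iff)
  then obtain x y where "X = embed C r (v * (1 + \<i> * of_real x))" "Y = embed C r (v * (1 + \<i> * of_real y))"
    using XY by blast
  then have "X - Y = (x - y) *\<^sub>R (- r * Im v, r * Re v)"
    by (simp add: embed_def algebra_simps)
  then show "\<exists>c. X - Y = c *\<^sub>R (- r * Im v, r * Re v)" by blast
qed

section \<open>Circumcenter, incenter and X36\<close>

lemma equidistant_unique:
  fixes M N P Q R :: point
  assumes nc: "\<not> collinear {P, Q, R}"
    and M: "dist M P = dist M Q" "dist M Q = dist M R"
    and N: "dist N P = dist N Q" "dist N Q = dist N R"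
  shows "M = N"
proof (rule ccontr)
  assume "M \<noteq> N"
  \<comment> \<open>Two distinct equidistant points make \<open>D\<close> orthogonal to all sides,
    so the sides are all parallel to \<open>D\<close> turned by a right angle.\<close>
  define D where "D = M - N"
  have D0: "(fst D)\<^sup>2 + (snd D)\<^sup>2 \<noteq> 0"
    using \<open>M \<noteq> N\<close> by (auto simp: D_def prod_eq_iff sum_power2_eq_zero_iff)
  have orth: "D \<bullet> (X - Y) = 0" if "dist M X = dist M Y" "dist N X = dist N Y" for X Y
  proof -
    have "(M - X) \<bullet> (M - X) = (M - Y) \<bullet> (M - Y)" "(N - X) \<bullet> (N - X) = (N - Y) \<bullet> (N - Y)"
      using that by (simp_all add: dist_norm dot_square_norm)
    then show ?thesis
      by (simp add: D_def inner_diff_left inner_diff_right inner_commute)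
  qed
  have "collinear {P, Q, R}"
    unfolding collinear_def
  proof (intro exI[of _ "(- snd D, fst D)"] ballI)
    fix X Y assume "X \<in> {P, Q, R}" "Y \<in> {P, Q, R}"
    then have "D \<bullet> (X - Y) = 0" using M N by (intro orth) auto
    then have o: "fst D * fst (X - Y) + snd D * snd (X - Y) = 0"
      by (cases D, cases "X - Y") simp
    define e where "e = X - Y"
    define c where "c = (fst D * snd e - snd D * fst e) / ((fst D)\<^sup>2 + (snd D)\<^sup>2)"
    have c: "c * ((fst D)\<^sup>2 + (snd D)\<^sup>2) = fst D * snd e - snd D * fst e"
      using D0 by (simp add: c_def)
    have "((fst D)\<^sup>2 + (snd D)\<^sup>2) * fst e = ((fst D)\<^sup>2 + (snd D)\<^sup>2) * (- c * snd D)"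
      "((fst D)\<^sup>2 + (snd D)\<^sup>2) * snd e = ((fst D)\<^sup>2 + (snd D)\<^sup>2) * (c * fst D)"
      using c o unfolding e_def[symmetric] by algebra+
    then have "fst e = - c * snd D" "snd e = c * fst D" using D0 by (metis mult_left_cancel)+
    then have "X - Y = c *\<^sub>R (- snd D, fst D)" unfolding e_def[symmetric] by (simp add: prod_eq_iff)
    then show "\<exists>c. X - Y = c *\<^sub>R (- snd D, fst D)" by blast
  qed
  with nc show False by simp
qed

text \<open>In signed tangent lengths the side vectors are i (x + y) v and so on, while y p + x q =
  (x + y) v. Since the side vectors add up to 0, so do the vertices weighted by y + z, z + x, x + y.
  Equal signs of x, y, z make these weights the side lengths up to one common sign.\<close>

lemma incenter_tangential:
  assumes r: "0 < r"
    and p: "p = u * (1 + \<i> * of_real x)" "p = v * (1 - \<i> * of_real x)"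
    and q: "q = v * (1 + \<i> * of_real y)" "q = w * (1 - \<i> * of_real y)"
    and s: "s = w * (1 + \<i> * of_real z)" "s = u * (1 - \<i> * of_real z)"
    and uni: "cmod u = 1" "cmod v = 1" "cmod w = 1"
    and sgn: "0 < x * y" "0 < y * z"
  shows "incenter (embed C r p) (embed C r q) (embed C r s) = C"
proof -
  have pq: "q - p = \<i> * of_real (x + y) * v" unfolding p(2) q(1) by (simp add: algebra_simps)
  have qs: "s - q = \<i> * of_real (y + z) * w" unfolding q(2) s(1) by (simp add: algebra_simps)
  have sp: "p - s = \<i> * of_real (z + x) * u" unfolding s(2) p(1) by (simp add: algebra_simps)
  have "\<i> * (of_real (x + y) * v + of_real (y + z) * w + of_real (z + x) * u) = (q - p) + (s - q) + (p - s)"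
    unfolding pq qs sp by (simp add: algebra_simps)
  then have sum: "of_real (x + y) * v + of_real (y + z) * w + of_real (z + x) * u = 0" by simp
  have "of_real y * p + of_real x * q = of_real (x + y) * v" unfolding p(2) q(1) by (simp add: algebra_simps)
  moreover have "of_real z * q + of_real y * s = of_real (y + z) * w" unfolding q(2) s(1) by (simp add: algebra_simps)
  moreover have "of_real x * s + of_real z * p = of_real (z + x) * u" unfolding s(2) p(1) by (simp add: algebra_simps)
  ultimately have "(of_real y * p + of_real x * q) + (of_real z * q + of_real y * s) + (of_real x * s + of_real z * p) = 0"
    using sum by simp
  then have zero: "of_real (y + z) * p + of_real (z + x) * q + of_real (x + y) * s = 0"
    by (simp add: algebra_simps)
  define e :: real where "e = sgn x"
  have e: "\<bar>x + y\<bar> = e * (x + y)" "\<bar>y + z\<bar> = e * (y + z)" "\<bar>z + x\<bar> = e * (z + x)"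
    using sgn by (auto simp: e_def zero_less_mult_iff)
  have d: "dist q s = e * (y + z)" "dist s p = e * (z + x)" "dist p q = e * (x + y)"
    using uni e by (simp_all add: dist_norm norm_minus_commute pq[symmetric] qs[symmetric] sp[symmetric])
      (metis pq qs sp norm_minus_commute norm_mult norm_ii norm_of_real mult_1 mult.right_neutral)+
  have pos: "0 < dist q s + dist s p + dist p q"
    using sgn unfolding d e[symmetric] by (auto simp: zero_less_mult_iff)
  let ?W = "dist q s + dist s p + dist p q"
  let ?g = "dist q s *\<^sub>R p + dist s p *\<^sub>R q + dist p q *\<^sub>R s"
  have "?g = of_real e * (of_real (y + z) * p + of_real (z + x) * q + of_real (x + y) * s)"
    unfolding d by (simp add: scaleR_conv_of_real algebra_simps)
  then have g: "?g = 0" using zero by simp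
  have "dist q s *\<^sub>R embed C r p + dist s p *\<^sub>R embed C r q + dist p q *\<^sub>R embed C r s =
      ?W *\<^sub>R C + (r * Re ?g, r * Im ?g)"
    by (simp add: embed_def prod_eq_iff algebra_simps)
  also have "\<dots> = ?W *\<^sub>R C" unfolding g by (simp add: zero_prod_def[symmetric])
  finally have W: "dist q s *\<^sub>R embed C r p + dist s p *\<^sub>R embed C r q + dist p q *\<^sub>R embed C r s = ?W *\<^sub>R C" .
  have "incenter (embed C r p) (embed C r q) (embed C r s) =
      (1 / (r * ?W)) *\<^sub>R (r *\<^sub>R (dist q s *\<^sub>R embed C r p + dist s p *\<^sub>R embed C r q + dist p q *\<^sub>R embed C r s))"
    unfolding incenter_def dist_embed[OF less_imp_le[OF r]] by (simp add: distrib_left scaleR_add_right)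
  then show ?thesis unfolding W using r pos by simp
qed

text \<open>Inversion in the unit circle sends the poles to the side midpoints of the touch
  triangle, on its nine-point circle with center S/2 and radius 1/2. Inverting that circle back
  gives this center and radius; the proof verifies the resulting equation.\<close>

lemma circumcenter_poles:
  assumes uni: "cmod u = 1" "cmod v = 1" "cmod w = 1" and nonanti: "u + v \<noteq> 0" "v + w \<noteq> 0" "w + u \<noteq> 0"
  defines "S \<equiv> u + v + w"
  shows "(cmod S)\<^sup>2 \<noteq> 1"
    and "cmod (pole u v - 2 * S / of_real ((cmod S)\<^sup>2 - 1)) = 2 / \<bar>(cmod S)\<^sup>2 - 1\<bar>"
proof -
  have [simp]: "u \<noteq> 0" "v \<noteq> 0" "w \<noteq> 0" using uni by auto
  define N where "N = (cmod S)\<^sup>2 - 1"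
  have cS: "cnj S = 1 / u + 1 / v + 1 / w"
    by (simp add: S_def unimodular_cnj[OF uni(1)] unimodular_cnj[OF uni(2)] unimodular_cnj[OF uni(3)])
  \<comment> \<open>This factorization makes \<open>N\<close> nonzero, because no two touch points
    are antipodal.\<close>
  have N: "of_real N * (u * v * w) = (u + v) * (v + w) * (w + u)"
    unfolding N_def of_real_diff complex_norm_square cS by (simp add: S_def field_simps)
  then have N0: "N \<noteq> 0" using nonanti by auto
  then show "(cmod S)\<^sup>2 \<noteq> 1" by (simp add: N_def)
  define p where "p = pole u v"
  have p: "p * (u + v) = 2 * (u * v)" "cnj p * (u + v) = 2"
    unfolding p_def cnj_pole[OF uni(1,2)]
    using nonanti(1)
    by (simp_all only: pole_def times_divide_eq_left nonzero_divide_eq_eq[OF nonanti(1)]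
        nonzero_mult_div_cancel_right mult.assoc)
  \<comment> \<open>The last factor is the circumcircle equation at \<open>p\<close>; the factors
    before it clear denominators.\<close>
  have "(u + v)\<^sup>2 * w * (of_real N * (p * cnj p) - 2 * (S * cnj p + cnj S * p) + 4) = 0"
  proof -
    have "(u * v) * ((u + v)\<^sup>2 * w * (of_real N * (p * cnj p) - 2 * (S * cnj p + cnj S * p) + 4)) =
      (of_real N * (u * v * w)) * ((p * (u + v)) * (cnj p * (u + v)))
      - 2 * (S * (u * v * w) * (u + v) * (cnj p * (u + v)) + (cnj S * (u * v * w)) * (u + v) * (p * (u + v)))
      + 4 * (u * v * w) * (u + v)\<^sup>2"
      by (simp add: algebra_simps power2_eq_square)
    also have "cnj S * (u * v * w) = v * w + u * w + u * v" unfolding cS by (simp add: field_simps)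
    also have "(of_real N * (u * v * w)) * ((p * (u + v)) * (cnj p * (u + v)))
      - 2 * (S * (u * v * w) * (u + v) * (cnj p * (u + v)) + (v * w + u * w + u * v) * (u + v) * (p * (u + v)))
      + 4 * (u * v * w) * (u + v)\<^sup>2 = 0"
      unfolding N p S_def by (simp add: algebra_simps power2_eq_square)
    finally show ?thesis by simp
  qed
  then have c: "of_real N * (p * cnj p) - 2 * (S * cnj p + cnj S * p) + 4 = 0"
    using nonanti by simp
  have "complex_of_real ((cmod (of_real N * p - 2 * S))\<^sup>2) =
      of_real N * (of_real N * (p * cnj p) - 2 * (S * cnj p + cnj S * p) + 4) + 4 * (S * cnj S - of_real N)"
    unfolding complex_norm_square by (simp add: algebra_simps)
  also have "\<dots> = complex_of_real (2\<^sup>2)"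
    unfolding c unfolding N_def of_real_diff complex_norm_square by simp
  finally have "(cmod (of_real N * p - 2 * S))\<^sup>2 = 2\<^sup>2" using of_real_eq_iff by blast
  then have "cmod (of_real N * p - 2 * S) = 2" by (metis norm_ge_zero power2_eq_imp_eq zero_le_numeral)
  moreover have "of_real N * p - 2 * S = of_real N * (p - 2 * S / of_real N)"
    using N0 by (simp add: right_diff_distrib)
  ultimately have "\<bar>N\<bar> * cmod (p - 2 * S / of_real N) = 2" by (simp add: norm_mult)
  then show "cmod (pole u v - 2 * S / of_real ((cmod S)\<^sup>2 - 1)) = 2 / \<bar>(cmod S)\<^sup>2 - 1\<bar>"
    unfolding N_def[symmetric] p_def using N0 by (simp add: field_simps)
qed

text \<open>The circumradius 2/|N| and the distance |O'| = 2|S|/|N| have squared ratio 1/|S|^2, in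
  which the scale \<open>r\<close> cancels. So the inverse of 0 is O' - O'/|S|^2 = 2 / cnj S. For S
  = 0 the two centers would coincide.\<close>

lemma X36_poles:
  assumes r: "0 < r" and uni: "cmod u = 1" "cmod v = 1" "cmod w = 1"
    and nonanti: "u + v \<noteq> 0" "v + w \<noteq> 0" "w + u \<noteq> 0"
    and nc: "\<not> collinear {embed C r (pole u v), embed C r (pole v w), embed C r (pole w u)}"
    and inc: "incenter (embed C r (pole u v)) (embed C r (pole v w)) (embed C r (pole w u)) = C"
    and S0: "u + v + w \<noteq> 0"
  shows "X36 (embed C r (pole u v)) (embed C r (pole v w)) (embed C r (pole w u)) =
    embed C r (2 / cnj (u + v + w))"
proof -
  define S where "S = u + v + w"
  define N where "N = (cmod S)\<^sup>2 - 1"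
  define O' where "O' = 2 * S / of_real N"
  have N0: "N \<noteq> 0" using circumcenter_poles(1)[OF uni nonanti] by (simp add: N_def S_def)
  have d: "cmod (pole u v - O') = 2 / \<bar>N\<bar>" "cmod (pole v w - O') = 2 / \<bar>N\<bar>" "cmod (pole w u - O') = 2 / \<bar>N\<bar>"
    using circumcenter_poles(2)[OF uni nonanti]
      circumcenter_poles(2)[OF uni(2,3,1) nonanti(2,3,1)]
      circumcenter_poles(2)[OF uni(3,1,2) nonanti(3,1,2)]
    unfolding O'_def N_def S_def by (simp_all add: add.commute add.left_commute)
  have cc: "circumcenter (embed C r (pole u v)) (embed C r (pole v w)) (embed C r (pole w u)) = embed C r O'"
    unfolding circumcenter_def
  proof (rule the_equality)
    show eq: "dist (embed C r O') (embed C r (pole u v)) = dist (embed C r O') (embed C r (pole v w)) \<and>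
        dist (embed C r O') (embed C r (pole v w)) = dist (embed C r O') (embed C r (pole w u))"
      unfolding dist_embed[OF less_imp_le[OF r]] using d by (simp add: dist_norm norm_minus_commute)
    show "M = embed C r O'" if "dist M (embed C r (pole u v)) = dist M (embed C r (pole v w)) \<and>
        dist M (embed C r (pole v w)) = dist M (embed C r (pole w u))" for M
      using equidistant_unique[OF nc] that eq by blast
  qed
  have "S \<noteq> 0" using S0 by (simp add: S_def)
  then have O0: "cmod O' \<noteq> 0" using N0 by (simp add: O'_def)
  have "(r * (2 / \<bar>N\<bar>))\<^sup>2 / (r * cmod O')\<^sup>2 = 1 / (cmod S)\<^sup>2"
    using r N0 by (simp add: O'_def norm_divide norm_mult power_mult_distrib power_divide)
  then have "X36 (embed C r (pole u v)) (embed C r (pole v w)) (embed C r (pole w u)) =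
      embed C r O' + (1 / (cmod S)\<^sup>2) *\<^sub>R (embed C r 0 - embed C r O')"
    unfolding X36_def circle_inverse_def circumradius_def cc inc
    using dist_embed[of r C O' 0] dist_embed[of r C O' "pole u v"] d(1) r
    by (simp add: dist_norm[of O'] norm_minus_commute)
  also have "\<dots> = embed C r (O' + of_real (1 / (cmod S)\<^sup>2) * (0 - O'))"
    by (rule embed_add_scaled)
  also have "O' + of_real (1 / (cmod S)\<^sup>2) * (0 - O') = 2 / cnj S"
  proof -
    have S: "S \<noteq> 0" "cnj S \<noteq> 0" using \<open>S \<noteq> 0\<close> by simp_all
    have NS: "of_real N = S * cnj S - 1" by (simp add: N_def flip: complex_norm_square)
    then have "S * cnj S - 1 \<noteq> 0" using N0 by (metis of_real_eq_0_iff)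
    then show ?thesis
      unfolding O'_def of_real_divide complex_norm_square NS using S by (simp add: divide_simps)
  qed
  finally show ?thesis by (simp add: S_def)
qed

text \<open>The first two poles span the tangent at \<open>v\<close>. If the third lay on it, it
  would be on the tangents at both \<open>v\<close> and \<open>w\<close>, hence be their pole,
  forcing u = v.\<close>

lemma not_collinear_poles:
  assumes r: "0 < r" and uni: "cmod u = 1" "cmod v = 1" "cmod w = 1"
    and dist: "u \<noteq> v" "v \<noteq> w" "u \<noteq> w"
    and nonanti: "u + v \<noteq> 0" "v + w \<noteq> 0" "w + u \<noteq> 0"
  shows "\<not> collinear {embed C r (pole u v), embed C r (pole v w), embed C r (pole w u)}"
proof
  assume col: "collinear {embed C r (pole u v), embed C r (pole v w), embed C r (pole w u)}"
  have nz: "u \<noteq> 0" "v \<noteq> 0" "w \<noteq> 0" using uni by auto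
  have "pole u v \<noteq> pole v w" using pole_eq_iff nz nonanti dist by blast
  then have "embed C r (pole u v) \<noteq> embed C r (pole v w)" using r by (simp add: embed_inject)
  then have "embed C r (pole w u) \<in> affine hull {embed C r (pole u v), embed C r (pole v w)}"
    using col collinear_3_affine_hull by blast
  then obtain t where "pole w u = pole u v + of_real t * (pole v w - pole u v)"
    using r by (auto simp: affine_hull_embed embed_inject)
  then have "pole w u = pole u v + t *\<^sub>R (pole v w - pole u v)"
    by (simp add: scaleR_conv_of_real)
  moreover have "pole u v \<bullet> v = 1" "pole v w \<bullet> v = 1" "pole w u \<bullet> w = 1"
    using pole_tangent uni nonanti by metis+
  ultimately have "pole w u \<bullet> v = 1" "pole w u \<bullet> w = 1" by (simp_all add: inner_add_left inner_diff_left)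
  then have "pole u w = pole w v"
    using pole_of_tangents(2)[of w v "pole w u"] uni dist by (simp add: pole_commute)
  then show False using pole_eq_iff[of u w v] nz nonanti dist by (simp add: add.commute)
qed

text \<open>The left side factors into rho^2 - (A - D)^2 and rho^2 - (A + D)^2; the bound rho^2 <
  A^2 - D^2 <= (A + D)^2 excludes the second.\<close>

lemma inradius_factor:
  fixes \<rho> :: real
  assumes "0 < \<rho>" "\<rho>\<^sup>2 < A\<^sup>2 - D\<^sup>2" "0 \<le> D" "0 \<le> A"
    and "(\<rho>\<^sup>2)\<^sup>2 - 2 * \<rho>\<^sup>2 * (A\<^sup>2 + D\<^sup>2) + (A\<^sup>2 - D\<^sup>2)\<^sup>2 = 0"
  shows "\<rho> = A - D"
proof -
  have "D\<^sup>2 < A\<^sup>2" using assms(2) zero_le_power2[of \<rho>] by linarith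
  then have "D < A" by (rule power2_less_imp_less) (rule assms(4))
  have "(\<rho>\<^sup>2 - (A - D)\<^sup>2) * (\<rho>\<^sup>2 - (A + D)\<^sup>2) = 0" using assms(5) by algebra
  moreover have "A\<^sup>2 - D\<^sup>2 \<le> (A + D)\<^sup>2" using assms(3,4) by (simp add: power2_sum)
  then have "\<rho>\<^sup>2 - (A + D)\<^sup>2 \<noteq> 0" using assms(2) by linarith
  ultimately have "\<rho>\<^sup>2 = (A - D)\<^sup>2" by simp
  then show ?thesis using assms(1) \<open>D < A\<close> by (simp add: power2_eq_iff_nonneg)
qed

section \<open>Triangles inscribed in an ellipse with a given incircle\<close>

lemma ellipse_mult: "a \<noteq> 0 \<Longrightarrow> b \<noteq> 0 \<Longrightarrow>
    (x, y) \<in> ellipse a b \<longleftrightarrow> a\<^sup>2 * b\<^sup>2 - b\<^sup>2 * x\<^sup>2 - a\<^sup>2 * y\<^sup>2 = 0"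
  by (simp add: ellipse_def field_simps)

lemma ellipse_interior_mult: "a \<noteq> 0 \<Longrightarrow> b \<noteq> 0 \<Longrightarrow>
    (x, y) \<in> ellipse_interior a b \<longleftrightarrow> 0 < a\<^sup>2 * b\<^sup>2 - b\<^sup>2 * x\<^sup>2 - a\<^sup>2 * y\<^sup>2"
proof -
  assume *: "a \<noteq> 0" "b \<noteq> 0"
  then have "a\<^sup>2 * b\<^sup>2 - b\<^sup>2 * x\<^sup>2 - a\<^sup>2 * y\<^sup>2 = (a\<^sup>2 * b\<^sup>2) * (1 - (x\<^sup>2 / a\<^sup>2 + y\<^sup>2 / b\<^sup>2))"
    by (simp add: field_simps)
  then show ?thesis using * by (auto simp: ellipse_interior_def zero_less_mult_iff mult_less_0_iff)
qed

text \<open>Restricted to the chord, the ellipse polynomial vanishes at t = 0 and t = 1, so it is t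
  (1 - t) times a sum of squares.\<close>

lemma chord_interior:
  assumes "a \<noteq> 0" "b \<noteq> 0" "P \<in> ellipse a b" "Q \<in> ellipse a b"
    and "P + t *\<^sub>R (Q - P) \<in> ellipse_interior a b"
  shows "0 < t * (1 - t)"
proof -
  obtain x y x' y' where P: "P = (x, y)" and Q: "Q = (x', y')" by (cases P, cases Q)
  define f where "f = (\<lambda>x y. a\<^sup>2 * b\<^sup>2 - b\<^sup>2 * x\<^sup>2 - a\<^sup>2 * y\<^sup>2)"
  have "f x y = 0" "f x' y' = 0" "0 < f (x + t * (x' - x)) (y + t * (y' - y))"
    using assms ellipse_mult ellipse_interior_mult by (auto simp: P Q f_def)
  moreover have "f (x + t * (x' - x)) (y + t * (y' - y)) =
      (1 - t) * f x y + t * f x' y' + t * (1 - t) * ((b * (x' - x))\<^sup>2 + (a * (y' - y))\<^sup>2)"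
    unfolding f_def by algebra
  ultimately have "0 < t * (1 - t) * ((b * (x' - x))\<^sup>2 + (a * (y' - y))\<^sup>2)" by simp
  then show ?thesis by (metis zero_less_mult_pos2 add_nonneg_nonneg zero_le_power2 less_le mult_zero_right)
qed

section \<open>The ellipse in the coordinates of the circle\<close>

locale circle_in_ellipse =
  fixes a b xc yc r :: real
  assumes b: "0 < b" and ab: "b < a" and int: "(xc, yc) \<in> ellipse_interior a b" and r: "0 < r"
begin

text \<open>Dividing the ellipse polynomial by its value \<open>K\<close> at the center of the
  circle makes the constant term 1; \<open>M\<close>, \<open>B\<close>, \<open>H\<close> are then
  its coefficients in the form \<open>conic\<close>, as \<open>quadric_eq\<close> confirms.\<close>

definition K where "K = a\<^sup>2 * b\<^sup>2 - b\<^sup>2 * xc\<^sup>2 - a\<^sup>2 * yc\<^sup>2"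
definition M where "M = r\<^sup>2 * (a\<^sup>2 - b\<^sup>2) / K"
definition B where "B = r\<^sup>2 * (a\<^sup>2 + b\<^sup>2) / (2 * K)"
definition H where "H = Complex (2 * r * b\<^sup>2 * xc / K) (2 * r * a\<^sup>2 * yc / K)"

abbreviation point_at :: "complex \<Rightarrow> point" where "point_at \<equiv> embed (xc, yc) r"

lemma K_pos: "0 < K"
  using ellipse_interior_mult int b ab unfolding K_def by auto

lemma c2_pos: "0 < a\<^sup>2 - b\<^sup>2"
  using b ab by (simp add: power_strict_mono)

lemma M_pos: "0 < M"
  unfolding M_def using K_pos c2_pos r by simp

lemma quadric_eq:
  "a\<^sup>2 * b\<^sup>2 - b\<^sup>2 * (xc + r * Re z)\<^sup>2 - a\<^sup>2 * (yc + r * Im z)\<^sup>2 = K * conic M B H z"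
proof -
  have "K * conic M B H z = K - (K * Re H * Re z + K * Im H * Im z) + K * M / 2 * ((Re z)\<^sup>2 - (Im z)\<^sup>2)
      - K * B * ((Re z)\<^sup>2 + (Im z)\<^sup>2)"
    unfolding conic_def cmod_power2 by (simp add: field_simps power2_eq_square)
  also have "K * Re H = 2 * r * b\<^sup>2 * xc" using K_pos by (simp add: H_def)
  also have "K * Im H = 2 * r * a\<^sup>2 * yc" using K_pos by (simp add: H_def)
  also have "K * M = r\<^sup>2 * (a\<^sup>2 - b\<^sup>2)" using K_pos by (simp add: M_def)
  also have "K * B = r\<^sup>2 * (a\<^sup>2 + b\<^sup>2) / 2" using K_pos by (simp add: B_def)
  finally show ?thesis by (simp add: K_def field_simps power2_eq_square)
qed

lemma point_at_ellipse: "point_at z \<in> ellipse a b \<longleftrightarrow> conic M B H z = 0"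
  using b ab K_pos by (simp add: embed_def ellipse_mult quadric_eq)

lemma point_at_interior: "point_at z \<in> ellipse_interior a b \<longleftrightarrow> 0 < conic M B H z"
  using b ab K_pos by (simp add: embed_def ellipse_interior_mult quadric_eq zero_less_mult_iff)

lemma norm_H: "(cmod H)\<^sup>2 = 4 * r\<^sup>2 * (b^4 * xc\<^sup>2 + a^4 * yc\<^sup>2) / K\<^sup>2"
  by (simp add: cmod_power2 H_def power_divide power_mult_distrib add_divide_distrib algebra_simps)

lemma M_less_1:
  assumes "sphere (xc, yc) r \<subseteq> ellipse_interior a b"
  shows "M < 1"
proof -
  \<comment> \<open>Selects the top or bottom point of the circle, whichever is farther from the
    major axis, so that the cross term has a definite sign.\<close>
  define s :: real where "s = (if yc < 0 then - 1 else 1)"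
  have "embed (xc, yc) r (\<i> * of_real s) \<in> sphere (xc, yc) r"
    unfolding embed_in_sphere[OF r] by (simp add: s_def norm_mult)
  then have "0 < a\<^sup>2 * b\<^sup>2 - b\<^sup>2 * xc\<^sup>2 - a\<^sup>2 * (yc + r * s)\<^sup>2"
    using assms b ab ellipse_interior_mult[of a b xc "yc + r * s"] by (auto simp: embed_def)
  also have "\<dots> = K - a\<^sup>2 * r\<^sup>2 * s\<^sup>2 - 2 * a\<^sup>2 * r * (yc * s)"
    unfolding K_def by algebra
  also have "\<dots> \<le> K - a\<^sup>2 * r\<^sup>2"
  proof -
    have "0 \<le> yc * s" "s\<^sup>2 = 1" by (auto simp: s_def)
    moreover from this have "0 \<le> 2 * a\<^sup>2 * r * (yc * s)" using r mult_nonneg_nonneg[of "2 * a\<^sup>2 * r" "yc * s"] by simp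
    ultimately show ?thesis by simp
  qed
  finally have "a\<^sup>2 * r\<^sup>2 < K" by simp
  moreover have "r\<^sup>2 * (a\<^sup>2 - b\<^sup>2) \<le> a\<^sup>2 * r\<^sup>2" by (simp add: algebra_simps)
  ultimately show ?thesis using K_pos by (simp add: M_def)
qed

text \<open>The difference (1 - M)^2 - |H|^2 = 4B - 2M = 4 r^2 b^2 / K is positive. This bound is
  what \<open>unimodular_root\<close> and \<open>touch_points_exist\<close> require.\<close>

lemma norm_H_less:
  assumes "M < 1" "4 * B = 1 + M\<^sup>2 - (cmod H)\<^sup>2"
  shows "cmod H < 1 - M"
proof -
  have "(1 - M)\<^sup>2 - (cmod H)\<^sup>2 = 4 * B - 2 * M"
    using assms(2) by (simp add: power2_eq_square algebra_simps)
  also have "\<dots> = 4 * r\<^sup>2 * b\<^sup>2 / K"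
    using K_pos by (simp add: B_def M_def field_simps)
  also have "\<dots> > 0" using K_pos r b by simp
  finally have "(cmod H)\<^sup>2 < (1 - M)\<^sup>2" by simp
  then show ?thesis by (rule power2_less_imp_less) (use assms(1) in simp)
qed

text \<open>For unimodular p the relation for \<open>B\<close> gives 4 \<open>conic M B H p\<close>
  = |2p - H|^2 - |p^2 - M|^2, and |p^2 - M| <= 1 + M < 2 - |H| <= |2p - H|.\<close>

lemma sphere_in_interior:
  assumes H: "cmod H < 1 - M" and B: "4 * B = 1 + M\<^sup>2 - (cmod H)\<^sup>2"
  shows "sphere (xc, yc) r \<subseteq> ellipse_interior a b"
proof
  fix X assume X: "X \<in> sphere (xc, yc) r"
  obtain p where Xp: "X = point_at p" using r by (metis embed_surj less_irrefl)
  have p: "cmod p = 1" using X embed_in_sphere[OF r] by (simp add: Xp)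
  have "cmod (p\<^sup>2 - of_real M) \<le> 1 + M"
    using norm_triangle_ineq4[of "p\<^sup>2" "of_real M"] M_pos p by (simp add: norm_power)
  also have "\<dots> < 2 - cmod H" using H by simp
  also have "\<dots> \<le> cmod (2 * p - H)"
    using norm_triangle_ineq2[of "2 * p" H] p by (simp add: norm_mult)
  finally have less: "(cmod (p\<^sup>2 - of_real M))\<^sup>2 < (cmod (2 * p - H))\<^sup>2"
    by (intro power_strict_mono) auto
  have p2: "(Re p)\<^sup>2 + (Im p)\<^sup>2 = 1" using p cmod_power2[of p] by simp
  have "4 * conic M B H p = 4 - 4 * Re (cnj H * p) + 2 * M * Re (p\<^sup>2) - 4 * B * ((Re p)\<^sup>2 + (Im p)\<^sup>2)"
    by (simp add: conic_def cmod_power2 algebra_simps)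
  also have "\<dots> = (cmod (2 * p - H))\<^sup>2 - (cmod (p\<^sup>2 - of_real M))\<^sup>2"
    unfolding B using p2 unfolding cmod_power2 by (simp add: power2_eq_square) algebra
  finally show "X \<in> ellipse_interior a b" using less by (simp add: Xp point_at_interior)
qed

lemma poncelet_triangleI:
  assumes uni: "cmod u = 1" "cmod v = 1" "cmod w = 1"
    and dist: "u \<noteq> v" "v \<noteq> w" "u \<noteq> w"
    and nonanti: "u + v \<noteq> 0" "v + w \<noteq> 0" "w + u \<noteq> 0"
    and S: "u + v + w = H + of_real M * (u * v * w)"
    and H: "cmod H < 1 - M" and B: "4 * B = 1 + M\<^sup>2 - (cmod H)\<^sup>2"
  shows "(point_at (pole u v), point_at (pole v w), point_at (pole w u)) \<in> poncelet_triangles a b (xc, yc)"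
proof -
  have S': "v + w + u = H + of_real M * (v * w * u)" "w + u + v = H + of_real M * (w * u * v)"
    using S by (simp_all add: add_ac mult_ac)
  have on: "point_at (pole u v) \<in> ellipse a b" "point_at (pole v w) \<in> ellipse a b" "point_at (pole w u) \<in> ellipse a b"
    unfolding point_at_ellipse
    using conic_pole_of_sum[OF uni nonanti(1) S B] conic_pole_of_sum[OF uni(2,3,1) nonanti(2) S'(1) B]
      conic_pole_of_sum[OF uni(3,1,2) nonanti(3) S'(2) B] by auto
  have tan: "tangent_to_circle (affine hull {point_at (pole x y), point_at (pole y z)}) (xc, yc) r"
    if "cmod x = 1" "cmod y = 1" "cmod z = 1" "x \<noteq> z" "x + y \<noteq> 0" "y + z \<noteq> 0" for x y z
  proof -
    have "x \<noteq> 0" "y \<noteq> 0" "z \<noteq> 0" using that by auto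
    then have ne: "pole x y \<noteq> pole y z" using pole_eq_iff that by blast
    show ?thesis unfolding tangent_to_circle_embed[OF r ne]
      using pole_tangent[of x y] pole_tangent[of y z] that by metis
  qed
  show ?thesis
    unfolding poncelet_triangles_def
    using on not_collinear_poles[OF r uni dist nonanti] r sphere_in_interior[OF H B]
      tan[of u v w] tan[of v w u] tan[of w u v] uni dist nonanti by auto
qed

text \<open>A touch point shared by two sides would make the vertices collinear. So the touch points
  are distinct, each vertex is the pole of the two on its sides, and \<open>sum_touch_points\<close>
  applies.\<close>

lemma touch_points_of_triangle:
  assumes on: "P \<in> ellipse a b" "Q \<in> ellipse a b" "R \<in> ellipse a b"
    and nc: "\<not> collinear {P, Q, R}"
    and nested: "sphere (xc, yc) r \<subseteq> ellipse_interior a b"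
    and tan: "tangent_to_circle (affine hull {P, Q}) (xc, yc) r"
      "tangent_to_circle (affine hull {Q, R}) (xc, yc) r"
      "tangent_to_circle (affine hull {R, P}) (xc, yc) r"
  obtains u v w where "cmod u = 1" "cmod v = 1" "cmod w = 1"
    "u + v \<noteq> 0" "v + w \<noteq> 0" "w + u \<noteq> 0"
    "P = point_at (pole u v)" "Q = point_at (pole v w)" "R = point_at (pole w u)"
    "u + v + w = H + of_real M * (u * v * w)" "4 * B = 1 + M\<^sup>2 - (cmod H)\<^sup>2"
    "incenter P Q R = (xc, yc)"
proof -
  obtain p q s where pqs: "P = point_at p" "Q = point_at q" "R = point_at s"
    using r by (metis embed_surj less_irrefl)
  have ne: "p \<noteq> q" "q \<noteq> s" "s \<noteq> p" using nc by (auto simp: pqs insert_commute)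
  obtain v where v: "cmod v = 1" "p \<bullet> v = 1" "q \<bullet> v = 1"
    using tan(1) tangent_to_circle_embed[OF r ne(1)] by (auto simp: pqs)
  obtain w where w: "cmod w = 1" "q \<bullet> w = 1" "s \<bullet> w = 1"
    using tan(2) tangent_to_circle_embed[OF r ne(2)] by (auto simp: pqs)
  obtain u where u: "cmod u = 1" "s \<bullet> u = 1" "p \<bullet> u = 1"
    using tan(3) tangent_to_circle_embed[OF r ne(3)] by (auto simp: pqs)
  have dist: "u \<noteq> v" "v \<noteq> w" "u \<noteq> w"
    using nc collinear_tangent_points[of v p q s] collinear_tangent_points[of w p q s] u v w
    by (auto simp: pqs)
  note p = pole_of_tangents[OF u(1) v(1) dist(1) u(3) v(2)]
  note q = pole_of_tangents[OF v(1) w(1) dist(2) v(3) w(2)]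
  note s = pole_of_tangents[OF w(1) u(1) dist(3)[symmetric] w(3) u(2)]
  have conic: "conic M B H (pole u v) = 0" "conic M B H (pole v w) = 0" "conic M B H (pole w u) = 0"
    using on p q s by (simp_all add: pqs point_at_ellipse)
  note sum = sum_touch_points[OF u(1) v(1) w(1) dist p(1) q(1) s(1) conic]
  obtain x where x: "p = u * (1 + \<i> * of_real x)" "p = v * (1 - \<i> * of_real x)"
    using pole_tangent[OF u(1) v(1) p(1)] p(2) by metis
  obtain y where y: "q = v * (1 + \<i> * of_real y)" "q = w * (1 - \<i> * of_real y)"
    using pole_tangent[OF v(1) w(1) q(1)] q(2) by metis
  obtain z where z: "s = w * (1 + \<i> * of_real z)" "s = u * (1 - \<i> * of_real z)"
    using pole_tangent[OF w(1) u(1) s(1)] s(2) by metis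
  \<comment> \<open>A touch point lies in the interior of the ellipse, hence strictly between the two vertices.\<close>
  have between: "0 < x * y"
    if "p = t * (1 - \<i> * of_real x)" "q = t * (1 + \<i> * of_real y)" "cmod t = 1"
      "p \<noteq> q" "point_at p \<in> ellipse a b" "point_at q \<in> ellipse a b" for p q t x y
  proof -
    have xy: "x + y \<noteq> 0"
    proof
      assume "x + y = 0"
      then have "y = - x" by simp
      then show False using that by simp
    qed
    define l where "l = x / (x + y)"
    have "point_at p + l *\<^sub>R (point_at q - point_at p) = point_at (p + of_real l * (q - p))"
      by (rule embed_add_scaled)
    also have "p + of_real l * (q - p) = t * (1 + \<i> * of_real (l * (x + y) - x))"
      unfolding that(1,2) by (simp add: algebra_simps)
    also have "l * (x + y) - x = 0" using xy by (simp add: l_def)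
    finally have "point_at p + l *\<^sub>R (point_at q - point_at p) = point_at t" by simp
    moreover have "point_at t \<in> ellipse_interior a b"
      using nested embed_in_sphere[OF r] that(3) by blast
    ultimately have "0 < l * (1 - l)"
      using chord_interior[of a b "point_at p" "point_at q" l] that b ab by simp
    then have "0 < (l * (1 - l)) * (x + y)\<^sup>2" using xy by simp
    also have "(l * (1 - l)) * (x + y)\<^sup>2 = (l * (x + y)) * ((x + y) - l * (x + y))"
      by (simp add: algebra_simps power2_eq_square)
    also have "l * (x + y) = x" using xy by (simp add: l_def)
    finally show ?thesis by simp
  qed
  have "incenter P Q R = (xc, yc)"
    unfolding pqs
    by (rule incenter_tangential[OF r x y z u(1) v(1) w(1)])
      (use between[OF x(2) y(1) v(1) ne(1)] between[OF y(2) z(1) w(1) ne(2)] on pqs in auto)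
  then show ?thesis using that u(1) v(1) w(1) p q s sum pqs by blast
qed

section \<open>X36 over the whole family\<close>

lemma X36_triangle:
  assumes uni: "cmod u = 1" "cmod v = 1" "cmod w = 1"
    and nonanti: "u + v \<noteq> 0" "v + w \<noteq> 0" "w + u \<noteq> 0"
    and nc: "\<not> collinear {point_at (pole u v), point_at (pole v w), point_at (pole w u)}"
    and inc: "incenter (point_at (pole u v)) (point_at (pole v w)) (point_at (pole w u)) = (xc, yc)"
    and S: "u + v + w = H + of_real M * (u * v * w)" and HM: "cmod H \<noteq> M"
  shows "X36 (point_at (pole u v)) (point_at (pole v w)) (point_at (pole w u)) =
    point_at (2 / cnj (H + of_real M * (u * v * w)))"
proof -
  \<comment> \<open>A zero sum would force |H| = M, so \<open>HM\<close> excludes triangles whose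
    circumcenter is the incenter.\<close>
  have "u + v + w \<noteq> 0"
  proof
    assume "u + v + w = 0"
    then have "H = - (of_real M * (u * v * w))" using S by (simp add: eq_neg_iff_add_eq_0)
    then have "cmod H = M" using uni M_pos by (simp add: norm_mult)
    with HM show False by simp
  qed
  then show ?thesis using X36_poles[OF r uni nonanti nc inc] S by simp
qed

lemma image_sphere: "point_at ` sphere z R = sphere (point_at z) (r * R)"
proof (intro set_eqI iffI)
  fix X assume "X \<in> sphere (point_at z) (r * R)"
  moreover obtain x where "X = point_at x" using r by (metis embed_surj less_irrefl)
  ultimately show "X \<in> point_at ` sphere z R" using r dist_embed[of r "(xc, yc)" z] by auto
next
  fix X assume "X \<in> point_at ` sphere z R"
  then show "X \<in> sphere (point_at z) (r * R)" using r dist_embed[of r "(xc, yc)" z] by auto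
qed

text \<open>The condition on \<open>r\<close> for the existence of triangles: necessary by
  \<open>M_less_1\<close> and \<open>sum_touch_points\<close>, and satisfied by only one radius by
  \<open>admissible_iff_radius\<close>.\<close>

definition admissible where
  "admissible \<longleftrightarrow> M < 1 \<and> 4 * B = 1 + M\<^sup>2 - (cmod H)\<^sup>2"

text \<open>The radius is existentially quantified for each triangle separately. Interpreting the
  locale at that radius shows it to be admissible, hence equal to \<open>r\<close>.\<close>

lemma poncelet_triangleE:
  assumes radius: "\<And>r'. circle_in_ellipse a b xc yc r' \<Longrightarrow>
      circle_in_ellipse.admissible a b xc yc r' \<Longrightarrow> r' = r"
    and T: "(P, Q, R) \<in> poncelet_triangles a b (xc, yc)"
  obtains u v w where "cmod u = 1" "cmod v = 1" "cmod w = 1"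
    "u + v \<noteq> 0" "v + w \<noteq> 0" "w + u \<noteq> 0"
    "P = point_at (pole u v)" "Q = point_at (pole v w)" "R = point_at (pole w u)"
    "u + v + w = H + of_real M * (u * v * w)" "\<not> collinear {P, Q, R}" "incenter P Q R = (xc, yc)"
proof -
  obtain r' where on: "P \<in> ellipse a b" "Q \<in> ellipse a b" "R \<in> ellipse a b"
    and nc: "\<not> collinear {P, Q, R}" and r': "0 < r'"
    and nested: "sphere (xc, yc) r' \<subseteq> ellipse_interior a b"
    and tan: "tangent_to_circle (affine hull {P, Q}) (xc, yc) r'"
      "tangent_to_circle (affine hull {Q, R}) (xc, yc) r'"
      "tangent_to_circle (affine hull {R, P}) (xc, yc) r'"
    using T unfolding poncelet_triangles_def by blast
  interpret R': circle_in_ellipse a b xc yc r'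
    using b ab int r' by unfold_locales
  have "R'.admissible"
    by (rule R'.touch_points_of_triangle[OF on nc nested tan])
      (simp add: R'.admissible_def R'.M_less_1[OF nested])
  then have "r' = r" by (rule radius[OF R'.circle_in_ellipse_axioms])
  then show ?thesis
    using touch_points_of_triangle[OF on nc] nested tan that nc by metis
qed

text \<open>\<open>X36\<close> depends on the triangle only through l = uvw, and
  \<open>touch_points_exist\<close> realizes every unimodular l. The locus is therefore the image of
  the unit circle under \<open>f\<close>, to which \<open>inverted_circle\<close> applies.\<close>

lemma locus_X36:
  assumes radius: "\<And>r'. circle_in_ellipse a b xc yc r' \<Longrightarrow>
      circle_in_ellipse.admissible a b xc yc r' \<Longrightarrow> r' = r"
    and adm: admissible and HM: "(cmod H)\<^sup>2 \<noteq> M\<^sup>2"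
  shows "locus X36 (poncelet_triangles a b (xc, yc)) =
    sphere (point_at (2 * H / of_real ((cmod H)\<^sup>2 - M\<^sup>2))) (r * (2 * M / \<bar>(cmod H)\<^sup>2 - M\<^sup>2\<bar>))"
proof -
  have M1: "M < 1" and B: "4 * B = 1 + M\<^sup>2 - (cmod H)\<^sup>2" using adm by (auto simp: admissible_def)
  note H = norm_H_less[OF M1 B]
  have HM': "cmod H \<noteq> M" using HM by auto
  define f where "f l = point_at (2 / cnj (H + of_real M * l))" for l
  have "X36 P Q R \<in> f ` {l. cmod l = 1}" if T: "(P, Q, R) \<in> poncelet_triangles a b (xc, yc)" for P Q R
  proof -
    obtain u v w where uvw: "cmod u = 1" "cmod v = 1" "cmod w = 1"
        "u + v \<noteq> 0" "v + w \<noteq> 0" "w + u \<noteq> 0"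
      and PQR: "P = point_at (pole u v)" "Q = point_at (pole v w)" "R = point_at (pole w u)"
      and S: "u + v + w = H + of_real M * (u * v * w)"
      and nc: "\<not> collinear {P, Q, R}" and inc: "incenter P Q R = (xc, yc)"
      by (rule poncelet_triangleE[OF radius T])
    have "X36 P Q R = f (u * v * w)"
      unfolding f_def PQR using X36_triangle[OF uvw _ _ S HM'] nc inc by (simp add: PQR)
    then show ?thesis using uvw by (auto simp: norm_mult)
  qed
  moreover have "f l \<in> locus X36 (poncelet_triangles a b (xc, yc))" if l: "cmod l = 1" for l
  proof -
    obtain u v w where uvw: "cmod u = 1" "cmod v = 1" "cmod w = 1"
      and S: "u + v + w = H + of_real M * l" and prod: "u * v * w = l"
      and dist: "u \<noteq> v" "v \<noteq> w" "u \<noteq> w" and nonanti: "u + v \<noteq> 0" "v + w \<noteq> 0" "w + u \<noteq> 0"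
      by (rule touch_points_exist[OF less_imp_le[OF M_pos] H l])
    have S': "u + v + w = H + of_real M * (u * v * w)" using S prod by simp
    note T = poncelet_triangleI[OF uvw dist nonanti S' H B]
    \<comment> \<open>Membership in the family already determines the incenter, so the signs of the
      tangent lengths need no second analysis.\<close>
    have inc: "incenter (point_at (pole u v)) (point_at (pole v w)) (point_at (pole w u)) = (xc, yc)"
      by (rule poncelet_triangleE[OF radius T])
    have "f l = X36 (point_at (pole u v)) (point_at (pole v w)) (point_at (pole w u))"
      unfolding f_def prod[symmetric]
      using X36_triangle[OF uvw nonanti not_collinear_poles[OF r uvw dist nonanti] inc S' HM'] by simp
    then show ?thesis using T unfolding locus_def by blast
  qed
  ultimately have "locus X36 (poncelet_triangles a b (xc, yc)) = f ` {l. cmod l = 1}"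
    unfolding locus_def by blast
  also have "\<dots> = point_at ` {2 / cnj (H + of_real M * l) | l. cmod l = 1}"
    unfolding f_def by blast
  finally show ?thesis
    unfolding inverted_circle[OF M_pos HM] image_sphere .
qed

text \<open>Multiplied by (e K)^2, the relation for \<open>B\<close> becomes the biquadratic of
  \<open>inradius_factor\<close> with rho = e r, A = b d, D = a f, and M < 1 becomes its bound,
  because A^2 - D^2 = e K.\<close>

lemma admissible_iff_radius:
  assumes d: "d\<^sup>2 = a^4 - (a\<^sup>2 - b\<^sup>2) * xc\<^sup>2" and f: "f\<^sup>2 = b^4 + (a\<^sup>2 - b\<^sup>2) * yc\<^sup>2"
    and nonneg: "0 \<le> d" "0 < f"
  shows "admissible \<longleftrightarrow> (a\<^sup>2 - b\<^sup>2) * r = b * d - a * f"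
proof -
  define e where "e = a\<^sup>2 - b\<^sup>2"
  have e: "0 < e" using c2_pos by (simp add: e_def)
  have a: "0 < a" using b ab by simp
  have diff: "(b * d)\<^sup>2 - (a * f)\<^sup>2 = e * K"
    unfolding power_mult_distrib d f K_def e_def by algebra
  have sum: "(b * d)\<^sup>2 + (a * f)\<^sup>2 = (a\<^sup>2 + b\<^sup>2) * K + 2 * (b^4 * xc\<^sup>2 + a^4 * yc\<^sup>2)"
    unfolding power_mult_distrib d f K_def by algebra
  have "M < 1 \<longleftrightarrow> r\<^sup>2 * e < K" using K_pos by (simp add: M_def e_def)
  also have "\<dots> \<longleftrightarrow> e * (r\<^sup>2 * e) < e * K" using e by simp
  finally have 1: "M < 1 \<longleftrightarrow> (e * r)\<^sup>2 < (b * d)\<^sup>2 - (a * f)\<^sup>2"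
    unfolding diff by (simp add: power2_eq_square mult_ac)
  have KH: "K\<^sup>2 * (cmod H)\<^sup>2 = 4 * r\<^sup>2 * (b^4 * xc\<^sup>2 + a^4 * yc\<^sup>2)"
    using K_pos by (simp add: norm_H)
  have "K\<^sup>2 * (1 + M\<^sup>2 - (cmod H)\<^sup>2 - 4 * B) =
      K\<^sup>2 + (K * M)\<^sup>2 - 4 * r\<^sup>2 * (b^4 * xc\<^sup>2 + a^4 * yc\<^sup>2) - 4 * K * (K * B)"
    using KH by (simp add: algebra_simps power2_eq_square)
  also have "K * M = r\<^sup>2 * e" using K_pos by (simp add: M_def e_def)
  also have "K * B = r\<^sup>2 * (a\<^sup>2 + b\<^sup>2) / 2" using K_pos by (simp add: B_def)
  finally have KE: "K\<^sup>2 * (1 + M\<^sup>2 - (cmod H)\<^sup>2 - 4 * B) =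
      K\<^sup>2 + (r\<^sup>2 * e)\<^sup>2 - 4 * r\<^sup>2 * (b^4 * xc\<^sup>2 + a^4 * yc\<^sup>2) - 4 * K * (r\<^sup>2 * (a\<^sup>2 + b\<^sup>2) / 2)" .
  have "(e * K)\<^sup>2 * (1 + M\<^sup>2 - (cmod H)\<^sup>2 - 4 * B) =
      ((e * r)\<^sup>2)\<^sup>2 - 2 * (e * r)\<^sup>2 * ((b * d)\<^sup>2 + (a * f)\<^sup>2) + ((b * d)\<^sup>2 - (a * f)\<^sup>2)\<^sup>2"
    unfolding sum diff power_mult_distrib[of e K] mult.assoc[of "e\<^sup>2"] KE
    by (simp add: algebra_simps power2_eq_square)
  moreover have "4 * B = 1 + M\<^sup>2 - (cmod H)\<^sup>2 \<longleftrightarrow> (e * K)\<^sup>2 * (1 + M\<^sup>2 - (cmod H)\<^sup>2 - 4 * B) = 0"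
    using e K_pos by auto
  ultimately have 2: "4 * B = 1 + M\<^sup>2 - (cmod H)\<^sup>2 \<longleftrightarrow>
      ((e * r)\<^sup>2)\<^sup>2 - 2 * (e * r)\<^sup>2 * ((b * d)\<^sup>2 + (a * f)\<^sup>2) + ((b * d)\<^sup>2 - (a * f)\<^sup>2)\<^sup>2 = 0"
    by simp
  show ?thesis
    unfolding admissible_def 1 2 e_def[symmetric]
  proof (intro iffI conjI; (elim conjE)?)
    assume "(e * r)\<^sup>2 < (b * d)\<^sup>2 - (a * f)\<^sup>2"
      "((e * r)\<^sup>2)\<^sup>2 - 2 * (e * r)\<^sup>2 * ((b * d)\<^sup>2 + (a * f)\<^sup>2) + ((b * d)\<^sup>2 - (a * f)\<^sup>2)\<^sup>2 = 0"
    then show "e * r = b * d - a * f"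
      using e r a b nonneg by (intro inradius_factor) auto
  next
    assume er: "e * r = b * d - a * f"
    show "((e * r)\<^sup>2)\<^sup>2 - 2 * (e * r)\<^sup>2 * ((b * d)\<^sup>2 + (a * f)\<^sup>2) + ((b * d)\<^sup>2 - (a * f)\<^sup>2)\<^sup>2 = 0"
      unfolding er by algebra
    \<comment> \<open>This product is (b d)^2 - (a f)^2 - (b d - a f)^2.\<close>
    have "0 < (b * d - a * f) * (2 * (a * f))"
      using e r a nonneg unfolding er[symmetric] by simp
    then show "(e * r)\<^sup>2 < (b * d)\<^sup>2 - (a * f)\<^sup>2"
      unfolding er by (simp add: algebra_simps power2_eq_square)
  qed
qed

text \<open>Admissibility gives |H|^2 - M^2 = 1 - 4B = W / K, which eliminates the quadratic
  expression for |H|^2.\<close>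

lemma locus_circle:
  assumes adm: admissible and N: "(cmod H)\<^sup>2 \<noteq> M\<^sup>2"
  defines "W \<equiv> K - 2 * r\<^sup>2 * (a\<^sup>2 + b\<^sup>2)"
  shows "point_at (2 * H / of_real ((cmod H)\<^sup>2 - M\<^sup>2)) =
      (xc * (1 + 4 * b\<^sup>2 * r\<^sup>2 / W), yc * (1 + 4 * a\<^sup>2 * r\<^sup>2 / W))"
    and "r * (2 * M / \<bar>(cmod H)\<^sup>2 - M\<^sup>2\<bar>) = 2 * (a\<^sup>2 - b\<^sup>2) * r^3 / \<bar>W\<bar>"
proof -
  have NW: "(cmod H)\<^sup>2 - M\<^sup>2 = W / K"
    using adm K_pos by (simp add: admissible_def B_def W_def field_simps)
  then have W: "W \<noteq> 0" using N by auto
  show "point_at (2 * H / of_real ((cmod H)\<^sup>2 - M\<^sup>2)) =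
      (xc * (1 + 4 * b\<^sup>2 * r\<^sup>2 / W), yc * (1 + 4 * a\<^sup>2 * r\<^sup>2 / W))"
    unfolding NW embed_def Re_divide_of_real Im_divide_of_real using W K_pos
    by (simp add: H_def field_simps power2_eq_square)
  show "r * (2 * M / \<bar>(cmod H)\<^sup>2 - M\<^sup>2\<bar>) = 2 * (a\<^sup>2 - b\<^sup>2) * r^3 / \<bar>W\<bar>"
    unfolding NW using W K_pos by (simp add: M_def abs_divide field_simps power2_eq_square power3_eq_cube)
qed

end

section \<open>Center and radius of the locus\<close>

text \<open>\<open>d\<close> and \<open>f\<close> stand for the two square roots and enter only
  through their squares, so each identity is polynomial modulo two relations. The repeated long
  factor is e^2 W, where e = a^2 - b^2, e r = b d - a f and W = K - 2 r^2 (a^2 + b^2).\<close>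

context
  fixes a b x y d f z1 z2 :: real
  assumes d: "d\<^sup>2 = a^4 - (a\<^sup>2 - b\<^sup>2) * x\<^sup>2" and f: "f\<^sup>2 = b^4 + (a\<^sup>2 - b\<^sup>2) * y\<^sup>2"
    and z2: "z2 = a^6 * b^2 - 9 * a^6 * y^2 - a^4 * b^2 * x^2"
    and z1: "z1 = z2 - 2 * a^4 * b^4 - 6 * a^4 * b^2 * y^2 + a^2 * b^6 - 6 * a^2 * b^4 * x^2
           - a^2 * b^4 * y^2 - 9 * b^6 * x^2"
begin

lemma center_x_identity:
  "(z2 - 6 * a^4 * b^4 + 6 * a^4 * b^2 * y^2 - 3 * a^2 * b^6
           - 2 * a^2 * b^4 * x^2 + 3 * a^2 * b^4 * y^2 - 8 * a * b^3 * (f * d) + 3 * b^6 * x^2)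
     * ((a\<^sup>2 - b\<^sup>2)\<^sup>2 * (a\<^sup>2 * b\<^sup>2 - b\<^sup>2 * x\<^sup>2 - a\<^sup>2 * y\<^sup>2) - 2 * (a\<^sup>2 + b\<^sup>2) * (b * d - a * f)\<^sup>2)
   = z1 * ((a\<^sup>2 - b\<^sup>2)\<^sup>2 * (a\<^sup>2 * b\<^sup>2 - b\<^sup>2 * x\<^sup>2 - a\<^sup>2 * y\<^sup>2) - 2 * (a\<^sup>2 + b\<^sup>2) * (b * d - a * f)\<^sup>2
     + 4 * b\<^sup>2 * (b * d - a * f)\<^sup>2)"
  using d f unfolding z1 z2 by algebra

lemma center_y_identity:
  "(3 * a^6 * (y^2 - b^2) - a^4 * (6 * b^4 + b^2 * (2 * y^2 - 3 * x^2))
           - 8 * a^3 * b * (f * d) + a^2 * b^4 * (b^2 + 6 * x^2 - y^2) - 9 * b^6 * x^2)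
     * ((a\<^sup>2 - b\<^sup>2)\<^sup>2 * (a\<^sup>2 * b\<^sup>2 - b\<^sup>2 * x\<^sup>2 - a\<^sup>2 * y\<^sup>2) - 2 * (a\<^sup>2 + b\<^sup>2) * (b * d - a * f)\<^sup>2)
   = z1 * ((a\<^sup>2 - b\<^sup>2)\<^sup>2 * (a\<^sup>2 * b\<^sup>2 - b\<^sup>2 * x\<^sup>2 - a\<^sup>2 * y\<^sup>2) - 2 * (a\<^sup>2 + b\<^sup>2) * (b * d - a * f)\<^sup>2
     + 4 * a\<^sup>2 * (b * d - a * f)\<^sup>2)"
  using d f unfolding z1 z2 by algebra

text \<open>Kept free of division so that it also shows W to be nonzero when z1 and b d - a f
  are.\<close>

lemma radius_identity:
  "(d * (5 * b * a^4 * y^2 - b^3 * a^2 * (a^2 + y^2 - x^2) + b^5 * (a^2 + 3 * x^2))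
     - f * (5 * a * b^4 * x^2 - a^3 * b^2 * (b^2 + x^2 - y^2) + a^5 * (b^2 + 3 * y^2)))
     * ((a\<^sup>2 - b\<^sup>2)\<^sup>2 * (a\<^sup>2 * b\<^sup>2 - b\<^sup>2 * x\<^sup>2 - a\<^sup>2 * y\<^sup>2) - 2 * (a\<^sup>2 + b\<^sup>2) * (b * d - a * f)\<^sup>2)
   = z1 * (b * d - a * f)^3"
  using d f unfolding z1 z2 by algebra

end

section \<open>Assembly of the closed forms\<close>

theorem proposition9:
  fixes a b c xc yc \<delta> \<delta>4 \<delta>4' z1 z2 x36 y36 z36 z36' r36 :: real
  assumes "0 < b" and "b < a" and "c\<^sup>2 = a\<^sup>2 - b\<^sup>2"
    and "(xc, yc) \<in> ellipse_interior a b"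
    and "\<delta> = sqrt ((b^4 + c^2 * yc^2) * (a^4 - c^2 * xc^2))"
    and "z2 = a^6 * b^2 - 9 * a^6 * yc^2 - a^4 * b^2 * xc^2"
    and "z1 = z2 - 2 * a^4 * b^4 - 6 * a^4 * b^2 * yc^2 + a^2 * b^6 - 6 * a^2 * b^4 * xc^2
           - a^2 * b^4 * yc^2 - 9 * b^6 * xc^2"
    and "z1 \<noteq> 0"
    and "x36 = xc * (z2 - 6 * a^4 * b^4 + 6 * a^4 * b^2 * yc^2 - 3 * a^2 * b^6
           - 2 * a^2 * b^4 * xc^2 + 3 * a^2 * b^4 * yc^2 - 8 * a * b^3 * \<delta> + 3 * b^6 * xc^2)"
    and "y36 = yc * (3 * a^6 * (yc^2 - b^2) - a^4 * (6 * b^4 + b^2 * (2 * yc^2 - 3 * xc^2))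
           - 8 * a^3 * b * \<delta> + a^2 * b^4 * (b^2 + 6 * xc^2 - yc^2) - 9 * b^6 * xc^2)"
    and "\<delta>4 = sqrt (a^4 - c^2 * xc^2)"
    and "\<delta>4' = sqrt (b^4 + c^2 * yc^2)"
    and "z36 = 5 * b * a^4 * yc^2 - b^3 * a^2 * (a^2 + yc^2 - xc^2) + b^5 * (a^2 + 3 * xc^2)"
    and "z36' = 5 * a * b^4 * xc^2 - a^3 * b^2 * (b^2 + xc^2 - yc^2) + a^5 * (b^2 + 3 * yc^2)"
    and "r36 = \<bar>2 * (\<delta>4 * z36 - \<delta>4' * z36') /
           (a^2 * b^2 * c^4 - b^2 * (a^2 + 3 * b^2)^2 * xc^2 - a^2 * (3 * a^2 + b^2)^2 * yc^2)\<bar>"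
  shows "0 < r36 \<and>
    locus X36 (poncelet_triangles a b (xc, yc)) = sphere (x36 / z1, y36 / z1) r36"
proof -
  have b: "0 < b" and ab: "b < a" and c: "c\<^sup>2 = a\<^sup>2 - b\<^sup>2"
    and int: "(xc, yc) \<in> ellipse_interior a b" and z2: "z2 = a^6 * b^2 - 9 * a^6 * yc^2 - a^4 * b^2 * xc^2"
    using assms by auto
  have a: "0 < a" using b ab by simp
  define e where "e = a\<^sup>2 - b\<^sup>2"
  have e: "0 < e" using b ab by (simp add: e_def power_strict_mono)
  define k where "k = a\<^sup>2 * b\<^sup>2 - b\<^sup>2 * xc\<^sup>2 - a\<^sup>2 * yc\<^sup>2"
  have k: "0 < k" using ellipse_interior_mult int a b by (auto simp: k_def)
  \<comment> \<open>The difference of the radicands, weighted by b^2 and a^2, is e k > 0. This makes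
    the radicand of \<open>\<delta>4\<close> positive and later gives b \<open>\<delta>4\<close> > a
    \<open>\<delta>4'\<close>.\<close>
  have "b\<^sup>2 * (a^4 - e * xc\<^sup>2) = e * k + a\<^sup>2 * (b^4 + e * yc\<^sup>2)" by (simp add: k_def e_def) algebra
  also have "\<dots> > a\<^sup>2 * (b^4 + e * yc\<^sup>2)" using e k by simp
  finally have G: "a\<^sup>2 * (b^4 + e * yc\<^sup>2) < b\<^sup>2 * (a^4 - e * xc\<^sup>2)" .
  have F: "0 < b^4 + e * yc\<^sup>2" using b e by (simp add: add_pos_nonneg)
  then have "0 < b\<^sup>2 * (a^4 - e * xc\<^sup>2)" using G a by (meson less_trans zero_less_mult_iff zero_less_power)
  then have G0: "0 < a^4 - e * xc\<^sup>2" using b by (simp add: zero_less_mult_iff)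
  have d2: "\<delta>4\<^sup>2 = a^4 - (a\<^sup>2 - b\<^sup>2) * xc\<^sup>2" and f2: "\<delta>4'\<^sup>2 = b^4 + (a\<^sup>2 - b\<^sup>2) * yc\<^sup>2"
    and d0: "0 \<le> \<delta>4" and f0: "0 < \<delta>4'"
    using F G0 unfolding assms(11,12) c e_def by simp_all
  have \<delta>: "\<delta> = \<delta>4' * \<delta>4" unfolding assms(5,11,12) by (simp add: real_sqrt_mult)
  have "(a * \<delta>4')\<^sup>2 < (b * \<delta>4)\<^sup>2" using G by (simp add: power_mult_distrib d2 f2 e_def)
  then have pos: "0 < b * \<delta>4 - a * \<delta>4'"
    using power2_less_imp_less[of "a * \<delta>4'" "b * \<delta>4"] b d0 by simp
  \<comment> \<open>The closed form of the inradius, positive by \<open>pos\<close>.\<close>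
  define r where "r = (b * \<delta>4 - a * \<delta>4') / e"
  have r: "0 < r" using pos e by (simp add: r_def)
  have er: "b * \<delta>4 - a * \<delta>4' = e * r" using e by (simp add: r_def)
  define W where "W = k - 2 * r\<^sup>2 * (a\<^sup>2 + b\<^sup>2)"
  have eW: "(a\<^sup>2 - b\<^sup>2)\<^sup>2 * (a\<^sup>2 * b\<^sup>2 - b\<^sup>2 * xc\<^sup>2 - a\<^sup>2 * yc\<^sup>2) - 2 * (a\<^sup>2 + b\<^sup>2) * (e * r)\<^sup>2 = e\<^sup>2 * W"
    unfolding W_def k_def e_def by (simp add: algebra_simps power2_eq_square)
  note ids = center_x_identity[OF d2 f2 assms(6,7)] center_y_identity[OF d2 f2 assms(6,7)]
    radius_identity[OF d2 f2 assms(6,7)]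
  have rad: "\<delta>4 * z36 - \<delta>4' * z36' = z1 * (e * r^3) / W" and W: "W \<noteq> 0"
  proof -
    have *: "(\<delta>4 * z36 - \<delta>4' * z36') * (e\<^sup>2 * W) = z1 * (e * r)^3"
      using ids(3) unfolding er eW assms(13,14) .
    then show W: "W \<noteq> 0" using assms(8) e r by auto
    have "e\<^sup>2 * ((\<delta>4 * z36 - \<delta>4' * z36') * W) = e\<^sup>2 * (z1 * (e * r^3))"
      using * by (simp add: algebra_simps power2_eq_square power3_eq_cube)
    then have "(\<delta>4 * z36 - \<delta>4' * z36') * W = z1 * (e * r^3)" using e by simp
    then show "\<delta>4 * z36 - \<delta>4' * z36' = z1 * (e * r^3) / W" using W by (simp add: nonzero_eq_divide_eq)
  qed
  have cancel: "t * X / z1 = t * (1 + 4 * k * r\<^sup>2 / W)"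
    if "X * (e\<^sup>2 * W) = z1 * (e\<^sup>2 * W + 4 * k * (e * r)\<^sup>2)" for t X k
  proof -
    have "e\<^sup>2 * (X * W) = e\<^sup>2 * (z1 * (W + 4 * k * r\<^sup>2))"
      using that by (simp add: algebra_simps power2_eq_square)
    then have "X * W = z1 * (W + 4 * k * r\<^sup>2)" using e by simp
    then have "X = z1 * (1 + 4 * k * r\<^sup>2 / W)" using W by (simp add: field_simps)
    then show ?thesis using assms(8) by simp
  qed
  have x36: "x36 / z1 = xc * (1 + 4 * b\<^sup>2 * r\<^sup>2 / W)" and y36: "y36 / z1 = yc * (1 + 4 * a\<^sup>2 * r\<^sup>2 / W)"
    unfolding assms(9,10) \<delta> using ids(1,2) unfolding er eW by (auto intro: cancel)
  have den: "a^2 * b^2 * c^4 - b^2 * (a^2 + 3 * b^2)^2 * xc^2 - a^2 * (3 * a^2 + b^2)^2 * yc^2 = z1"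
  proof -
    have "c^4 = (a\<^sup>2 - b\<^sup>2)\<^sup>2" by (simp add: c[symmetric])
    then show ?thesis unfolding assms(7) z2 by algebra
  qed
  have r36: "r36 = 2 * (a\<^sup>2 - b\<^sup>2) * r^3 / \<bar>W\<bar>"
    unfolding assms(15) den rad e_def[symmetric] using assms(8) e r by (simp add: abs_mult abs_divide)
  interpret circle_in_ellipse a b xc yc r using b ab int r by unfold_locales
  have K_eq: "K = k" by (simp only: K_def k_def)
  have adm: admissible
    using admissible_iff_radius[OF d2 f2 d0 f0] er by (simp add: e_def)
  have "(cmod H)\<^sup>2 - M\<^sup>2 = W / k"
    using adm k by (simp add: admissible_def B_def W_def K_eq field_simps)
  then have N: "(cmod H)\<^sup>2 \<noteq> M\<^sup>2" using W k by auto
  \<comment> \<open>Any admissible radius solves the same linear equation, with coefficient e >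
    0.\<close>
  have "r' = r" if "circle_in_ellipse a b xc yc r'" "circle_in_ellipse.admissible a b xc yc r'" for r'
    using circle_in_ellipse.admissible_iff_radius[OF that(1) d2 f2 d0 f0] that(2) er e
    by (simp add: e_def)
  then have "locus X36 (poncelet_triangles a b (xc, yc)) =
      sphere (point_at (2 * H / of_real ((cmod H)\<^sup>2 - M\<^sup>2))) (r * (2 * M / \<bar>(cmod H)\<^sup>2 - M\<^sup>2\<bar>))"
    by (rule locus_X36[OF _ adm N])
  also have "\<dots> = sphere (x36 / z1, y36 / z1) r36"
    unfolding locus_circle[OF adm N] x36 y36 r36 K_eq W_def ..
  finally have "locus X36 (poncelet_triangles a b (xc, yc)) = sphere (x36 / z1, y36 / z1) r36" .
  moreover have "0 < r36" unfolding r36 using W e r by (simp add: e_def)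
  ultimately show ?thesis by simp
qed

end
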